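(* (i) Let $X$ be a random vector in $\mathbb R^d$ with $\mathbb E[XX^\top]=I_d$ and assume that there are constants $C\ge1$ and $\alpha\in(0,1]$ such that $\mathbb P(|\langle\theta,X\rangle|\le t)\le(Ct)^\alpha$ for every $\theta\in S^{d-1}$ and $t>0$. Let $C'=3C^4e^{1+9/\alpha}$, and assume $n\ge6d/\alpha$ and $n\ge12/\alpha$. Then for any $1\le q\le\alpha n/12$, $$\big\|\max\big(1,\lambda_{\min}(\widehat\Sigma_n)^{-1}\big)\big\|_{L^q}\le2^{1/q}\cdot C'.$$ Conversely, the previous inequality (holding for all $1\le q\le\alpha n/12$) implies that $\mathbb P(\lambda_{\min}(\widehat\Sigma_n)\le t)\le(2C't)^{\alpha n/12}$ for all $t\in(0,1)$. (ii) For any $d\ge2$ and any random vector $X$ in $\mathbb R^d$ such that $\mathbb E[XX^\top]=I_d$, we have for any $q\ge n/2$ $$\big\|\lambda_{\min}(\widehat\Sigma_n)^{-1}\big\|_{L^q}=+\infty .$$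
   Context: $n\ge1$ is an integer, $X_1,\dots,X_n$ are i.i.d. copies of $X$, $\widehat\Sigma_n=\frac1n\sum_{i=1}^nX_iX_i^\top$, $\lambda_{\min}(A)$ denotes the smallest eigenvalue of a symmetric matrix $A$ (with the convention $0^{-1}=+\infty$), $S^{d-1}$ is the Euclidean unit sphere of $\mathbb R^d$ and $I_d$ the identity matrix. For $q\ge1$, $\|Z\|_{L^q}=\mathbb E[|Z|^q]^{1/q}\in[0,+\infty]$. *)

theory Defs
  imports "HOL-Probability.Probability"
begin

definition outer :: "real^'d \<Rightarrow> real^'d^'d" where
  "outer x = (\<chi> i j. x $ i * x $ j)"

(* has_bochner_integral includes integrability, i.e. finite second moments. *)
definition identity_second_moment :: "'b measure \<Rightarrow> ('b \<Rightarrow> real^'d) \<Rightarrow> bool" where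
  "identity_second_moment N X \<longleftrightarrow> has_bochner_integral N (\<lambda>\<omega>. outer (X \<omega>)) (mat 1)"

(* X and its copies may live on different probability spaces N and M. *)
definition iid_copies ::
    "'a measure \<Rightarrow> nat \<Rightarrow> (nat \<Rightarrow> 'a \<Rightarrow> real^'d) \<Rightarrow> 'b measure \<Rightarrow> ('b \<Rightarrow> real^'d) \<Rightarrow> bool" where
  "iid_copies M n Xs N X \<longleftrightarrow>
     prob_space.indep_vars M (\<lambda>_. borel) Xs {1..n} \<and>
     (\<forall>i\<in>{1..n}. distr M borel (Xs i) = distr N borel X)"

definition sample_cov :: "nat \<Rightarrow> (nat \<Rightarrow> 'a \<Rightarrow> real^'d) \<Rightarrow> 'a \<Rightarrow> real^'d^'d" where
  "sample_cov n Xs \<omega> = (1 / real n) *\<^sub>R (\<Sum>i=1..n. outer (Xs i \<omega>))"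

definition eigenvalues :: "real^'d^'d \<Rightarrow> real set" where
  "eigenvalues A = {\<mu>. \<exists>v. v \<noteq> 0 \<and> A *v v = \<mu> *\<^sub>R v}"

(* Meaningful for symmetric A, whose set of real eigenvalues is finite and nonempty. *)
definition lambda_min :: "real^'d^'d \<Rightarrow> real" where
  "lambda_min A = Min (eigenvalues A)"

(* x to the power r for x in [0, \<infinity>] and r > 0. *)
definition ennreal_powr :: "ennreal \<Rightarrow> real \<Rightarrow> ennreal" where
  "ennreal_powr x r = (if x = \<infinity> then \<infinity> else ennreal (enn2real x powr r))"

(* For Z with values in [0, \<infinity>], so that no absolute value is needed. *)
definition Lq_norm :: "'a measure \<Rightarrow> real \<Rightarrow> ('a \<Rightarrow> ennreal) \<Rightarrow> ennreal" where
  "Lq_norm M q Z = ennreal_powr (\<integral>\<^sup>+\<omega>. ennreal_powr (Z \<omega>) q \<partial>M) (1 / q)"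

(* The inverse is taken in ennreal, where inverse 0 = \<infinity>.  The coercion loses nothing,
   as the sample covariance matrix is positive semidefinite. *)
definition inv_lambda_min :: "nat \<Rightarrow> (nat \<Rightarrow> 'a \<Rightarrow> real^'d) \<Rightarrow> 'a \<Rightarrow> ennreal" where
  "inv_lambda_min n Xs \<omega> = inverse (ennreal (lambda_min (sample_cov n Xs \<omega>)))"

end

theory Submission
  imports Defs
begin

text \<open>
  The smallest eigenvalue of the sample covariance matrix S is the minimum over unit vectors v of
  the quadratic form v.Sv, the mean of the squares (v.X_i)^2. Moments of its inverse and its
  lower tail determine each other up to constants and a factor 2 in the exponent, so part (i)
  reduces to the tail bound
  lambda_min_lower_tail: P(lambda_min S \<le> t) \<le> (C't)^(\<alpha>n/6).

  For one fixed direction such a bound is immediate: by independence the Laplace transform of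
  the sum of the (\<theta>.X_i)^2 at l = 1/t is an n-th power, and the small-ball hypothesis makes
  each factor of order (C^2/l)^(\<alpha>/2) (laplace_transform_small_ball). The difficulty is to make it
  uniform over the sphere with a constant free of the dimension d. A net argument would need a
  mesh of order sqrt(t/d) and lose a factor d^(d/2). Instead the Laplace functional is integrated
  over all \<theta> in the shell 1 \<le> |\<theta>| \<le> 1 + 2r. If S has a unit eigenvector v with eigenvalue at
  most t, the shell contains the ball of radius r about w = (1+r)v, and by Jensen's inequality
  the integral over this ball is at least its volume times the exponential of minus the mean of
  the quadratic form. This mean is the value at w plus a contribution of at most
  r^2 tr(S) / d (exp_neg_sum_squares_cball_ge): the isotropy of the ball divides the trace by
  d, and so r can be chosen independently of d. The price is the ratio ((1+2r)/r)^d of the volumes, which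
  n \<ge> 6d/\<alpha> turns into a small power of 1/t per observation.

  The trace has to be bounded for this. Observations with |X_i| > R, where
  R^2 = d l^(\<alpha>/2), are replaced by 0; this decreases S, gives tr(S) \<le> R^2, and by Markov's
  inequality for E|X|^2 = d it adds only l^(-\<alpha>/2) to each Laplace factor, the order that it
  has already. With r^2 l R^2 = d the total is at most (const C^\<alpha> t^(3\<alpha>/8))^n, and the surplus of
  3\<alpha>/8 over \<alpha>/6 absorbs all constants once C't \<le> 1 (lower_tail_constant_bound).

  For part (ii), two coordinates of X span a plane in which X has norm at most 2 with probability
  at least 1/2. Every vector of that disc is within 2/K of being orthogonal to one of O(K) grid
  directions, so by the pigeonhole principle a single direction v has P(|v.X| \<le> 2/K) of order at
  least 1/K (exists_direction_small_ball_ge). All n observations satisfy this together with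
  probability at least (12K)^(-n), and then lambda_min S \<le> 4/K^2. Hence
  P(1/lambda_min S \<ge> u) is at least of order u^(-n/2), and the moment of order n/2 diverges
  logarithmically.
\<close>

section \<open>The smallest eigenvalue as a minimum of quadratic forms\<close>

text \<open>
  A minimiser v of the Rayleigh quotient on the sphere is an eigenvector, because the first
  variation of the nonnegative form g x = x.Ax - \<mu> (x.x) vanishes at its zero v; its eigenvalue
  \<mu> is then the least one. Eigenvectors of distinct eigenvalues are orthogonal, so the set of
  eigenvalues is finite and Min returns \<mu>.
\<close>
lemma lambda_min_symmetric:
  fixes A :: "real^'d^'d"
  assumes sym: "\<And>x y. x \<bullet> (A *v y) = (A *v x) \<bullet> y"
  shows lambda_min_le_rayleigh: "lambda_min A * (norm x)\<^sup>2 \<le> x \<bullet> (A *v x)"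
    and lambda_min_attained: "\<exists>v. norm v = 1 \<and> v \<bullet> (A *v v) = lambda_min A"
proof -
  have "\<exists>v\<in>sphere (0::real^'d) 1. \<forall>y\<in>sphere 0 1. v \<bullet> (A *v v) \<le> y \<bullet> (A *v y)"
    by (rule continuous_attains_inf) (auto intro!: continuous_intros matrix_vector_mult_linear_continuous_on)
  then obtain v where nv: "norm v = 1" and vmin: "\<And>y. norm y = 1 \<Longrightarrow> v \<bullet> (A *v v) \<le> y \<bullet> (A *v y)"
    by auto
  define \<mu> where "\<mu> = v \<bullet> (A *v v)"
  define g where "g x = x \<bullet> (A *v x) - \<mu> * (x \<bullet> x)" for x
  have g_nonneg: "g x \<ge> 0" for x
  proof (cases "x = 0")
    case False
    have "x = norm x *\<^sub>R sgn x" using False by (simp add: sgn_div_norm)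
    then have "x \<bullet> (A *v x) = (norm x *\<^sub>R sgn x) \<bullet> (A *v (norm x *\<^sub>R sgn x))" by simp
    also have "\<dots> = (norm x)\<^sup>2 * (sgn x \<bullet> (A *v sgn x))"
      by (simp only: matrix_vector_mult_scaleR inner_scaleR_left inner_scaleR_right power2_eq_square mult_ac)
    finally have "x \<bullet> (A *v x) = (norm x)\<^sup>2 * (sgn x \<bullet> (A *v sgn x))" .
    moreover have "(norm x)\<^sup>2 * \<mu> \<le> (norm x)\<^sup>2 * (sgn x \<bullet> (A *v sgn x))"
      unfolding \<mu>_def using False by (intro mult_left_mono vmin) (auto simp: norm_sgn)
    ultimately show ?thesis by (simp add: g_def power2_norm_eq_inner mult.commute)
  qed (simp add: g_def)
  have "v \<bullet> v = 1" using nv by (simp add: norm_eq_1)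
  define w where "w = A *v v - \<mu> *\<^sub>R v"
  have g_line: "g (v + t *\<^sub>R w) = 2 * t * (w \<bullet> w) + t\<^sup>2 * g w" for t
  proof -
    have 1: "v \<bullet> (A *v w) = w \<bullet> (A *v v)" by (metis sym inner_commute)
    have 2: "w \<bullet> (A *v v) = w \<bullet> w + \<mu> * (w \<bullet> v)" by (simp add: w_def inner_diff_right)
    have "g (v + t *\<^sub>R w) = (v \<bullet> (A *v v) + t * (v \<bullet> (A *v w)) + t * (w \<bullet> (A *v v))
        + t * t * (w \<bullet> (A *v w))) - \<mu> * (v \<bullet> v + 2 * t * (w \<bullet> v) + t * t * (w \<bullet> w))"
      unfolding g_def matrix_vector_right_distrib matrix_vector_mult_scaleR inner_add_left inner_add_right
        inner_scaleR_left inner_scaleR_right by (simp add: inner_commute[of v w] algebra_simps)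
    also have "\<dots> = 2 * t * (w \<bullet> w) + t\<^sup>2 * g w"
      unfolding 1 2 \<open>v \<bullet> v = 1\<close> \<mu>_def[symmetric] g_def by (simp add: algebra_simps power2_eq_square)
    finally show ?thesis .
  qed
  have "w = 0"
  proof (rule ccontr)
    assume "w \<noteq> 0"
    then have pos: "w \<bullet> w > 0" by simp
    \<comment> \<open>A step of this length against w makes the linear term dominate the quadratic one.\<close>
    define s where "s = (w \<bullet> w) / (g w + 1)"
    have "s > 0" unfolding s_def using pos g_nonneg[of w] by simp
    have "s * g w \<le> w \<bullet> w" unfolding s_def using pos g_nonneg[of w] by (simp add: divide_simps)
    have "0 \<le> s * (s * g w - 2 * (w \<bullet> w))"
      using g_nonneg[of "v + (- s) *\<^sub>R w"] unfolding g_line by (simp add: algebra_simps power2_eq_square)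
    then have "2 * (w \<bullet> w) \<le> s * g w" using \<open>s > 0\<close> by (simp add: zero_le_mult_iff)
    then show False using \<open>s * g w \<le> w \<bullet> w\<close> pos by simp
  qed
  have mem: "\<mu> \<in> eigenvalues A"
    unfolding eigenvalues_def using nv \<open>w = 0\<close> by (auto simp: w_def intro!: exI[of _ v])
  have low: "\<mu> \<le> \<nu>" if "\<nu> \<in> eigenvalues A" for \<nu>
  proof -
    from that obtain u where u: "u \<noteq> 0" "A *v u = \<nu> *\<^sub>R u" by (auto simp: eigenvalues_def)
    then have "u \<bullet> u > 0" by simp
    then show ?thesis using g_nonneg[of u] u(2) by (simp add: g_def)
  qed
  have fin: "finite (eigenvalues A)"
  proof -
    have "\<exists>e. \<forall>\<nu>\<in>eigenvalues A. e \<nu> \<noteq> 0 \<and> A *v e \<nu> = \<nu> *\<^sub>R e \<nu>"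
      by (rule bchoice) (auto simp: eigenvalues_def)
    then obtain e where e: "\<And>\<nu>. \<nu> \<in> eigenvalues A \<Longrightarrow> e \<nu> \<noteq> 0 \<and> A *v e \<nu> = \<nu> *\<^sub>R e \<nu>"
      by blast
    have orth: "e \<nu> \<bullet> e \<kappa> = 0" if "\<nu> \<in> eigenvalues A" "\<kappa> \<in> eigenvalues A" "\<nu> \<noteq> \<kappa>" for \<nu> \<kappa>
      using sym[of "e \<nu>" "e \<kappa>"] e[OF that(1)] e[OF that(2)] that(3) by simp
    have inj: "inj_on e (eigenvalues A)"
      using orth e by (intro inj_onI) (metis inner_eq_zero_iff)
    have "independent (e ` eigenvalues A)"
      using e orth by (intro pairwise_orthogonal_independent) (auto simp: pairwise_def orthogonal_def)
    then show ?thesis using inj finite_imageD finiteI_independent by blast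
  qed
  have eq: "lambda_min A = \<mu>"
    unfolding lambda_min_def using mem low fin by (intro Min_eqI)
  show "lambda_min A * (norm x)\<^sup>2 \<le> x \<bullet> (A *v x)"
    using g_nonneg[of x] by (simp add: eq g_def power2_norm_eq_inner)
  show "\<exists>v. norm v = 1 \<and> v \<bullet> (A *v v) = lambda_min A"
    using nv by (auto simp: eq \<mu>_def)
qed

lemma sample_cov_mult_vec:
  "sample_cov n Xs \<omega> *v v = (1 / real n) *\<^sub>R (\<Sum>i=1..n. (Xs i \<omega> \<bullet> v) *\<^sub>R Xs i \<omega>)"
  unfolding vec_eq_iff
proof
  fix k
  have "(sample_cov n Xs \<omega> *v v) $ k
      = (\<Sum>j\<in>UNIV. (1 / real n) * (\<Sum>i=1..n. Xs i \<omega> $ k * Xs i \<omega> $ j) * v $ j)"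
    by (simp add: sample_cov_def outer_def matrix_vector_mult_def sum_component)
  also have "\<dots> = (1 / real n) * (\<Sum>i=1..n. \<Sum>j\<in>UNIV. Xs i \<omega> $ k * Xs i \<omega> $ j * v $ j)"
    by (subst sum.swap) (simp add: sum_distrib_left sum_distrib_right mult_ac)
  also have "\<dots> = (1 / real n) * (\<Sum>i=1..n. (Xs i \<omega> \<bullet> v) * Xs i \<omega> $ k)"
    by (simp add: inner_vec_def sum_distrib_left sum_distrib_right mult_ac)
  finally show "(sample_cov n Xs \<omega> *v v) $ k
      = ((1 / real n) *\<^sub>R (\<Sum>i=1..n. (Xs i \<omega> \<bullet> v) *\<^sub>R Xs i \<omega>)) $ k"
    by (simp add: sum_component)
qed

lemma sample_cov_quadratic_form:
  "v \<bullet> (sample_cov n Xs \<omega> *v v) = (\<Sum>i=1..n. (v \<bullet> Xs i \<omega>)\<^sup>2) / real n"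
  by (simp add: sample_cov_mult_vec inner_sum_right power2_eq_square inner_commute)

lemma sample_cov_self_adjoint:
  "x \<bullet> (sample_cov n Xs \<omega> *v y) = (sample_cov n Xs \<omega> *v x) \<bullet> y"
  by (simp add: sample_cov_mult_vec inner_sum_right inner_sum_left inner_commute mult.commute)

lemma lambda_min_sample_cov_le:
  "lambda_min (sample_cov n Xs \<omega>) * (norm v)\<^sup>2 \<le> (\<Sum>i=1..n. (v \<bullet> Xs i \<omega>)\<^sup>2) / real n"
  using lambda_min_le_rayleigh[OF sample_cov_self_adjoint] by (simp add: sample_cov_quadratic_form)

lemma lambda_min_sample_cov_attained:
  obtains v where "norm v = 1"
    and "lambda_min (sample_cov n Xs \<omega>) = (\<Sum>i=1..n. (v \<bullet> Xs i \<omega>)\<^sup>2) / real n"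
  using lambda_min_attained[OF sample_cov_self_adjoint, of n Xs \<omega>] by (auto simp: sample_cov_quadratic_form)

lemma lambda_min_sample_cov_nonneg: "lambda_min (sample_cov n Xs \<omega>) \<ge> 0"
  by (metis lambda_min_sample_cov_attained sum_nonneg zero_le_power2 of_nat_0_le_iff divide_nonneg_nonneg)

text \<open>
  The eigenvalue is at least c if and only if v.Sv \<ge> c |v|^2 for all v; as both sides are continuous in v, it
  suffices to test this on a countable dense set.
\<close>
lemma lambda_min_sample_cov_measurable:
  fixes Xs :: "nat \<Rightarrow> 'a \<Rightarrow> real^'d"
  assumes "\<And>i. i \<in> {1..n} \<Longrightarrow> Xs i \<in> borel_measurable M"
  shows "(\<lambda>\<omega>. lambda_min (sample_cov n Xs \<omega>)) \<in> borel_measurable M"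
proof (rule borel_measurableI_ge)
  fix c :: real
  define q where "q v \<omega> = (\<Sum>i=1..n. (v \<bullet> Xs i \<omega>)\<^sup>2) / real n - c * (norm v)\<^sup>2" for v \<omega>
  obtain D :: "(real^'d) set" where D: "countable D"
      "\<And>U. open U \<Longrightarrow> U \<noteq> {} \<Longrightarrow> \<exists>d \<in> D. d \<in> U"
    by (erule countable_dense_setE)
  have iff: "c \<le> lambda_min (sample_cov n Xs \<omega>) \<longleftrightarrow> (\<forall>v\<in>D. q v \<omega> \<ge> 0)" for \<omega>
  proof
    assume c: "c \<le> lambda_min (sample_cov n Xs \<omega>)"
    show "\<forall>v\<in>D. q v \<omega> \<ge> 0"
    proof
      fix v :: "real^'d"
      have "c * (norm v)\<^sup>2 \<le> lambda_min (sample_cov n Xs \<omega>) * (norm v)\<^sup>2"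
        using c by (intro mult_right_mono) auto
      then show "q v \<omega> \<ge> 0" using lambda_min_sample_cov_le[of n Xs \<omega> v] by (simp add: q_def)
    qed
  next
    assume D0: "\<forall>v\<in>D. q v \<omega> \<ge> 0"
    have "open {v. q v \<omega> < 0}"
      unfolding q_def divide_inverse by (intro open_Collect_less continuous_intros)
    then have "{v. q v \<omega> < 0} = {}"
      using D(2)[of "{v. q v \<omega> < 0}"] D0 by fastforce
    then have all: "q v \<omega> \<ge> 0" for v by (auto simp: not_less)
    obtain v where "norm v = 1" "lambda_min (sample_cov n Xs \<omega>) = (\<Sum>i=1..n. (v \<bullet> Xs i \<omega>)\<^sup>2) / real n"
      by (rule lambda_min_sample_cov_attained)
    then show "c \<le> lambda_min (sample_cov n Xs \<omega>)" using all[of v] by (simp add: q_def)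
  qed
  have [measurable]: "q v \<in> borel_measurable M" for v
    unfolding q_def[abs_def] using assms by (intro borel_measurable_diff borel_measurable_divide
      borel_measurable_sum borel_measurable_power borel_measurable_inner) auto
  have "{\<omega> \<in> space M. c \<le> lambda_min (sample_cov n Xs \<omega>)} = space M - (\<Union>v\<in>D. {\<omega>\<in>space M. q v \<omega> < 0})"
    by (auto simp: iff not_less)
  also have "\<dots> \<in> sets M"
    by (intro sets.Diff sets.top sets.countable_UN'[OF D(1)]) auto
  finally show "{\<omega> \<in> space M. c \<le> lambda_min (sample_cov n Xs \<omega>)} \<in> sets M" .
qed

section \<open>Averages of quadratic forms over balls\<close>

lemma lborel_swap_coordinates:
  fixes a b :: "'a::euclidean_space"
  assumes a: "a \<in> Basis" and b: "b \<in> Basis"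
  defines "T \<equiv> \<lambda>x::'a. \<Sum>j\<in>Basis. (x \<bullet> Transposition.transpose a b j) *\<^sub>R j"
  shows "distr lborel borel T = (lborel :: 'a measure)"
proof (rule lborel_eqI[symmetric])
  let ?\<sigma> = "Transposition.transpose a b"
  have \<sigma>: "?\<sigma> j \<in> Basis" if "j \<in> Basis" for j
    using a b that by (auto simp: Transposition.transpose_def)
  have Tj: "T x \<bullet> j = x \<bullet> ?\<sigma> j" if "j \<in> Basis" for x j
    unfolding T_def using that by simp
  have bij: "bij_betw ?\<sigma> Basis Basis"
    using \<sigma> by (intro bij_betwI[where g="?\<sigma>"]) auto
  have [measurable]: "T \<in> borel \<rightarrow>\<^sub>M borel" by (simp add: T_def)
  fix l u :: 'a assume le: "\<And>j. j \<in> Basis \<Longrightarrow> l \<bullet> j \<le> u \<bullet> j"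
  have vim: "T -` box l u = box (T l) (T u)"
  proof (intro set_eqI iffI)
    fix x assume "x \<in> T -` box l u"
    then have h: "l \<bullet> j < x \<bullet> ?\<sigma> j \<and> x \<bullet> ?\<sigma> j < u \<bullet> j" if "j \<in> Basis" for j
      using that by (auto simp: mem_box Tj)
    show "x \<in> box (T l) (T u)"
      unfolding mem_box using h[OF \<sigma>] by (auto simp: Tj)
  next
    fix x assume "x \<in> box (T l) (T u)"
    then have h: "l \<bullet> ?\<sigma> j < x \<bullet> j \<and> x \<bullet> j < u \<bullet> ?\<sigma> j" if "j \<in> Basis" for j
      using that by (auto simp: mem_box Tj)
    show "x \<in> T -` box l u"
      using h[OF \<sigma>] by (auto simp: Tj mem_box)
  qed
  have "emeasure (distr lborel borel T) (box l u) = emeasure lborel (box (T l) (T u))"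
    by (simp add: emeasure_distr vim)
  also have "\<dots> = (\<Prod>j\<in>Basis. (u - l) \<bullet> ?\<sigma> j)"
    by (subst emeasure_lborel_box) (auto simp: Tj le \<sigma> inner_diff_left intro!: prod.cong)
  also have "\<dots> = (\<Prod>j\<in>Basis. (u - l) \<bullet> j)"
    using prod.reindex_bij_betw[OF bij, of "\<lambda>j. (u - l) \<bullet> j"] by simp
  finally show "emeasure (distr lborel borel T) (box l u) = (\<Prod>j\<in>Basis. (u - l) \<bullet> j)" .
qed simp

lemma lborel_reflect_coordinate:
  fixes a :: "'a::euclidean_space"
  assumes a: "a \<in> Basis"
  shows "distr lborel borel (\<lambda>x. x - (2 * (x \<bullet> a)) *\<^sub>R a) = (lborel :: 'a measure)"
proof -
  let ?c = "\<lambda>j. if j = a then -1 else 1 :: real"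
  have eq: "(\<Sum>j\<in>Basis. (?c j * (x \<bullet> j)) *\<^sub>R j) = x - (2 * (x \<bullet> a)) *\<^sub>R a" for x
  proof (rule euclidean_eqI)
    fix j :: 'a assume "j \<in> Basis"
    then show "(\<Sum>j\<in>Basis. (?c j * (x \<bullet> j)) *\<^sub>R j) \<bullet> j = (x - (2 * (x \<bullet> a)) *\<^sub>R a) \<bullet> j"
      using a by (simp add: inner_diff_left inner_Basis)
  qed
  have "(\<Prod>j\<in>Basis. \<bar>?c j\<bar>) = 1" by (intro prod.neutral) auto
  then show ?thesis
    using lborel_affine_euclidean[of ?c 0] by (simp add: eq density_1)
qed

lemma integrable_on_cball:
  fixes f :: "'a::euclidean_space \<Rightarrow> real"
  assumes "continuous_on UNIV f"
  shows "integrable lborel (\<lambda>u. indicator (cball 0 r) u * f u)"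
  using borel_integrable_compact[of "cball 0 r" f] assms continuous_on_subset by fastforce

text \<open>
  A map that preserves both Lebesgue measure and the norm can be substituted in integrals over
  centred balls.
\<close>
lemma integral_cball_isometry:
  fixes f :: "'a::euclidean_space \<Rightarrow> real"
  assumes T: "distr lborel borel T = (lborel :: 'a measure)" and [measurable]: "T \<in> borel \<rightarrow>\<^sub>M borel"
    and norm: "\<And>u. norm (T u) = norm u" and [measurable]: "f \<in> borel_measurable borel"
  shows "(\<integral>u. indicator (cball 0 r) u * f (T u) \<partial>lborel) = (\<integral>u. indicator (cball 0 r) u * f u \<partial>lborel)"
proof -
  have [measurable]: "cball (0::'a) r \<in> sets borel" by simp
  have "(\<integral>u. indicator (cball 0 r) u * f u \<partial>lborel)
      = (\<integral>u. indicator (cball 0 r) u * f u \<partial>(distr lborel borel T))" by (simp add: T)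
  also have "\<dots> = (\<integral>u. indicator (cball 0 r) (T u) * f (T u) \<partial>lborel)"
    by (rule integral_distr) measurable
  also have "\<dots> = (\<integral>u. indicator (cball 0 r) u * f (T u) \<partial>lborel)"
    by (intro Bochner_Integration.integral_cong) (auto simp: norm split: split_indicator)
  finally show ?thesis by simp
qed

lemma cball_mean_zero:
  fixes x :: "'a::euclidean_space"
  shows "(\<integral>u. indicator (cball 0 r) u * (x \<bullet> u) \<partial>lborel) = 0"
proof -
  have "distr lborel borel uminus = (lborel :: 'a measure)"
    using lborel_affine[of "-1" "0::'a"] by (simp add: density_1 uminus_add_conv_diff[symmetric] del: uminus_add_conv_diff)
  from integral_cball_isometry[OF this, of "\<lambda>u. x \<bullet> u" r] show ?thesis by simp
qed

text \<open>
  Isotropy of the ball: its second moment matrix has no off-diagonal entries by invariance under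
  coordinate reflections, and equal diagonal entries by invariance under coordinate swaps, so it
  is a multiple s of the identity. Taking the trace, d s is the integral of |u|^2, which is at
  most r^2 times the volume.
\<close>
lemma cball_second_moment:
  fixes x :: "'a::euclidean_space"
  shows "(\<integral>u. indicator (cball 0 r) u * (x \<bullet> u)\<^sup>2 \<partial>lborel)
    \<le> r\<^sup>2 * (norm x)\<^sup>2 / DIM('a) * measure lborel (cball (0::'a) r)"
proof -
  let ?I = "\<lambda>f. \<integral>u. indicator (cball (0::'a) r) u * (f u :: real) \<partial>lborel"
  define m where "m a b = ?I (\<lambda>u. (u \<bullet> a) * (u \<bullet> b))" for a b
  have off: "m a b = 0" if "a \<in> Basis" "b \<in> Basis" "a \<noteq> b" for a b :: 'a
  proof -
    let ?T = "\<lambda>x. x - (2 * (x \<bullet> a)) *\<^sub>R a"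
    have n: "norm (?T u) = norm u" for u
      using that by (simp add: norm_eq inner_diff_left inner_diff_right inner_commute algebra_simps)
    have "?I (\<lambda>u. (?T u \<bullet> a) * (?T u \<bullet> b)) = m a b"
      unfolding m_def by (rule integral_cball_isometry[OF lborel_reflect_coordinate[OF that(1)] _ n]) measurable
    moreover have "?I (\<lambda>u. (?T u \<bullet> a) * (?T u \<bullet> b)) = ?I (\<lambda>u. - ((u \<bullet> a) * (u \<bullet> b)))"
      using that by (simp add: inner_diff_left inner_Basis algebra_simps)
    ultimately show ?thesis unfolding m_def by simp
  qed
  obtain b0 :: 'a where b0: "b0 \<in> Basis" using nonempty_Basis by blast
  define s where "s = m b0 b0"
  have diag: "m a a = s" if a: "a \<in> Basis" for a
  proof -
    let ?T = "\<lambda>x::'a. \<Sum>j\<in>Basis. (x \<bullet> Transposition.transpose a b0 j) *\<^sub>R j"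
    have \<sigma>: "bij_betw (Transposition.transpose a b0) Basis Basis"
      using a b0 by (intro bij_betwI[where g="Transposition.transpose a b0"])
        (auto simp: Transposition.transpose_def)
    have n: "norm (?T u) = norm u" for u
    proof -
      have "?T u \<bullet> ?T u = (\<Sum>j\<in>Basis. (u \<bullet> Transposition.transpose a b0 j)\<^sup>2)"
        by (subst euclidean_inner) (simp add: power2_eq_square)
      also have "\<dots> = (\<Sum>j\<in>Basis. (u \<bullet> j)\<^sup>2)"
        using sum.reindex_bij_betw[OF \<sigma>, of "\<lambda>j. (u \<bullet> j)\<^sup>2"] by simp
      also have "\<dots> = u \<bullet> u" by (subst euclidean_inner) (simp add: power2_eq_square)
      finally show ?thesis by (simp add: norm_eq)
    qed
    have "?I (\<lambda>u. (?T u \<bullet> a) * (?T u \<bullet> a)) = m a a"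
      unfolding m_def by (rule integral_cball_isometry[OF lborel_swap_coordinates[OF a b0] _ n]) measurable
    then show ?thesis using a by (simp add: s_def m_def)
  qed
  have int: "integrable lborel (\<lambda>u. indicator (cball (0::'a) r) u * f u)" if "continuous_on UNIV f" for f :: "'a \<Rightarrow> real"
    using that by (rule integrable_on_cball)
  have ib: "integrable lborel (\<lambda>u. indicator (cball (0::'a) r) u * ((u \<bullet> a) * (u \<bullet> b)))" for a b
    by (intro int continuous_intros)
  have "?I (\<lambda>u. (x \<bullet> u)\<^sup>2) = (\<Sum>a\<in>Basis. \<Sum>b\<in>Basis. ((x \<bullet> a) * (x \<bullet> b)) * m a b)"
  proof -
    have "(x \<bullet> u)\<^sup>2 = (\<Sum>a\<in>Basis. \<Sum>b\<in>Basis. ((x \<bullet> a) * (x \<bullet> b)) * ((u \<bullet> a) * (u \<bullet> b)))" for u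
      by (subst euclidean_inner) (simp add: power2_eq_square sum_product mult_ac)
    then have "?I (\<lambda>u. (x \<bullet> u)\<^sup>2) = (\<integral>u. (\<Sum>a\<in>Basis. \<Sum>b\<in>Basis.
        ((x \<bullet> a) * (x \<bullet> b)) * (indicator (cball (0::'a) r) u * ((u \<bullet> a) * (u \<bullet> b)))) \<partial>lborel)"
      by (simp add: sum_distrib_left mult_ac)
    also have "\<dots> = (\<Sum>a\<in>Basis. \<Sum>b\<in>Basis. ((x \<bullet> a) * (x \<bullet> b)) * m a b)"
      unfolding m_def
      by (simp only: Bochner_Integration.integral_sum Bochner_Integration.integrable_sum
        integrable_mult_right ib integral_mult_right_zero simp_thms)
    finally show ?thesis .
  qed
  also have "\<dots> = (\<Sum>a\<in>Basis. (x \<bullet> a)\<^sup>2 * s)"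
  proof (rule sum.cong[OF refl])
    fix a :: 'a assume a: "a \<in> Basis"
    have "(\<Sum>b\<in>Basis. ((x \<bullet> a) * (x \<bullet> b)) * m a b) = (\<Sum>b\<in>Basis. if b = a then (x \<bullet> a)\<^sup>2 * s else 0)"
      by (rule sum.cong[OF refl]) (use a off diag in \<open>auto simp: power2_eq_square\<close>)
    then show "(\<Sum>b\<in>Basis. ((x \<bullet> a) * (x \<bullet> b)) * m a b) = (x \<bullet> a)\<^sup>2 * s" using a by simp
  qed
  also have "\<dots> = (norm x)\<^sup>2 * s"
    by (simp add: sum_distrib_right[symmetric] norm_le_l1 power2_norm_eq_inner)
       (subst euclidean_inner, simp add: power2_eq_square)
  finally have 1: "?I (\<lambda>u. (x \<bullet> u)\<^sup>2) = (norm x)\<^sup>2 * s" .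
  have "real DIM('a) * s = (\<Sum>a\<in>(Basis::'a set). m a a)" by (simp add: diag)
  also have "\<dots> = (\<integral>u. (\<Sum>a\<in>Basis. indicator (cball (0::'a) r) u * ((u \<bullet> a) * (u \<bullet> a))) \<partial>lborel)"
    unfolding m_def by (subst Bochner_Integration.integral_sum) (auto intro!: int continuous_intros)
  also have "\<dots> = ?I (\<lambda>u. (norm u)\<^sup>2)"
    by (simp add: sum_distrib_left[symmetric] power2_norm_eq_inner euclidean_inner[symmetric])
  also have "\<dots> \<le> ?I (\<lambda>u. r\<^sup>2)"
    by (intro integral_mono int continuous_intros) (auto split: split_indicator intro!: power_mono)
  also have "\<dots> = r\<^sup>2 * measure lborel (cball (0::'a) r)"
    by simp
  finally have "s \<le> r\<^sup>2 * measure lborel (cball (0::'a) r) / DIM('a)"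
    by (simp add: field_simps)
  then have "(norm x)\<^sup>2 * s \<le> (norm x)\<^sup>2 * (r\<^sup>2 * measure lborel (cball (0::'a) r) / DIM('a))"
    by (intro mult_left_mono) auto
  then show ?thesis by (simp add: 1 mult_ac)
qed

text \<open>
  Jensen's inequality for the uniform distribution on a ball about w. In w + u the quadratic form
  is its value at w, plus a linear term in u, which has mean zero, plus the form at u, whose
  mean is at most r^2 / d times its trace.
\<close>
lemma exp_neg_sum_squares_cball_ge:
  fixes x :: "'i \<Rightarrow> 'a::euclidean_space" and w :: 'a
  shows "(\<integral>\<^sup>+\<theta>. indicator (cball w r) \<theta> * ennreal (exp (- (\<Sum>i\<in>I. (\<theta> \<bullet> x i)\<^sup>2))) \<partial>lborel)
    \<ge> ennreal (measure lborel (cball (0::'a) r)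
        * exp (- ((\<Sum>i\<in>I. (w \<bullet> x i)\<^sup>2) + r\<^sup>2 * (\<Sum>i\<in>I. (norm (x i))\<^sup>2) / DIM('a))))"
proof -
  let ?V = "measure lborel (cball (0::'a) r)"
  define f where "f \<theta> = (\<Sum>i\<in>I. (\<theta> \<bullet> x i)\<^sup>2)" for \<theta>
  define S where "S = (\<Sum>i\<in>I. (norm (x i))\<^sup>2)"
  define m where "m = f w + r\<^sup>2 * S / DIM('a)"
  define a where "a = (\<Sum>i\<in>I. (w \<bullet> x i) *\<^sub>R x i)"
  have [measurable]: "f \<in> borel_measurable borel" unfolding f_def by measurable
  have [measurable]: "cball c r \<in> sets borel" for c :: 'a by simp
  have expand: "f (w + u) = f w + 2 * (a \<bullet> u) + f u" for u
  proof -
    have "((w + u) \<bullet> x i)\<^sup>2 = (w \<bullet> x i)\<^sup>2 + 2 * ((w \<bullet> x i) * (x i \<bullet> u)) + (u \<bullet> x i)\<^sup>2" for i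
      by (simp add: inner_add_left power2_sum inner_commute[of u])
    then show ?thesis
      by (simp add: f_def a_def sum.distrib inner_sum_left sum_distrib_left)
  qed
  have int: "integrable lborel (\<lambda>u. indicator (cball (0::'a) r) u * h u)" if "continuous_on UNIV h" for h :: "'a \<Rightarrow> real"
    using that by (rule integrable_on_cball)
  let ?I = "\<lambda>f. \<integral>u. indicator (cball (0::'a) r) u * (f u :: real) \<partial>lborel"
  have If: "?I f \<le> r\<^sup>2 * S / DIM('a) * ?V"
  proof -
    have "?I f = (\<Sum>i\<in>I. ?I (\<lambda>u. (x i \<bullet> u)\<^sup>2))"
      unfolding f_def sum_distrib_left
      by (subst Bochner_Integration.integral_sum) (auto intro!: int continuous_intros simp: inner_commute)
    also have "\<dots> \<le> (\<Sum>i\<in>I. r\<^sup>2 * (norm (x i))\<^sup>2 / DIM('a) * ?V)"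
      by (intro sum_mono cball_second_moment)
    also have "\<dots> = r\<^sup>2 * S / DIM('a) * ?V"
      by (simp add: S_def sum_distrib_left sum_distrib_right sum_divide_distrib)
    finally show ?thesis .
  qed
  have cf: "continuous_on UNIV f" unfolding f_def by (intro continuous_intros)
  \<comment> \<open>Jensen's inequality for exp, through the tangent line at the mean.\<close>
  have tangent: "exp (- m) * (1 + (m - f (w + u))) \<le> exp (- f (w + u))" for u
  proof -
    have "exp (- m) * (1 + (m - f (w + u))) \<le> exp (- m) * exp (m - f (w + u))"
      by (intro mult_left_mono exp_ge_add_one_self) auto
    then show ?thesis by (simp add: exp_add[symmetric])
  qed
  have "?I (\<lambda>u. 1 + (m - f (w + u))) = ?I (\<lambda>u. (1 + m - f w)) - 2 * ?I (\<lambda>u. a \<bullet> u) - ?I f"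
  proof -
    have "?I (\<lambda>u. 1 + (m - f (w + u))) = (\<integral>u. indicator (cball (0::'a) r) u * (1 + m - f w)
        - 2 * (indicator (cball (0::'a) r) u * (a \<bullet> u)) - indicator (cball (0::'a) r) u * f u \<partial>lborel)"
      unfolding expand by (intro Bochner_Integration.integral_cong) (auto simp: algebra_simps)
    also have "\<dots> = ?I (\<lambda>u. (1 + m - f w)) - 2 * ?I (\<lambda>u. a \<bullet> u) - ?I f"
      by (subst Bochner_Integration.integral_diff Bochner_Integration.integral_diff integral_mult_right_zero;
          (intro Bochner_Integration.integrable_diff integrable_mult_right int continuous_intros cf)?)+ simp
    finally show ?thesis .
  qed
  also have "\<dots> \<ge> ?V"
  proof -
    have "?I (\<lambda>u. (1 + m - f w)) = ?V * (1 + m - f w)" by simp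
    moreover have "?V * (1 + m - f w) = ?V + r\<^sup>2 * S / DIM('a) * ?V" by (simp add: m_def algebra_simps)
    ultimately show ?thesis using If by (simp only: cball_mean_zero)
  qed
  finally have "?V * exp (- m) \<le> exp (- m) * ?I (\<lambda>u. 1 + (m - f (w + u)))"
    by simp
  also have "\<dots> = ?I (\<lambda>u. exp (- m) * (1 + (m - f (w + u))))"
    by (simp add: mult.left_commute flip: integral_mult_right_zero)
  also have "\<dots> \<le> ?I (\<lambda>u. exp (- f (w + u)))"
    unfolding f_def
    by (intro integral_mono int continuous_intros)
       (use tangent in \<open>auto simp: f_def split: split_indicator\<close>)
  finally have "ennreal (?V * exp (- m)) \<le> ennreal (?I (\<lambda>u. exp (- f (w + u))))"
    by (rule ennreal_leI)
  also have "\<dots> = (\<integral>\<^sup>+u. ennreal (indicator (cball (0::'a) r) u * exp (- f (w + u))) \<partial>lborel)"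
    unfolding f_def by (intro nn_integral_eq_integral[symmetric] int continuous_intros) auto
  also have "\<dots> = (\<integral>\<^sup>+u. indicator (cball w r) (w + u) * ennreal (exp (- f (w + u))) \<partial>lborel)"
    by (intro nn_integral_cong) (auto split: split_indicator simp: dist_norm)
  also have "\<dots> = (\<integral>\<^sup>+\<theta>. indicator (cball w r) \<theta> * ennreal (exp (- f \<theta>)) \<partial>(distr lborel borel (\<lambda>u. w + u)))"
    by (subst nn_integral_distr) simp_all
  also have "distr lborel borel (\<lambda>u. w + u) = lborel"
    using lborel_affine[of 1 w] by (simp add: density_1)
  finally show ?thesis by (simp add: f_def m_def S_def)
qed

section \<open>Laplace transforms and small-ball probabilities\<close>

lemma powr_half_le_linear:
  fixes s a :: real
  assumes "0 \<le> s" "0 < a" "a \<le> 1"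
  shows "s powr (a / 2) \<le> 1 + s / 2"
proof (cases "s \<le> 1")
  case True
  then have "s powr (a / 2) \<le> 1 powr (a / 2)" using assms by (intro powr_mono2) auto
  then show ?thesis using assms by simp
next
  case False
  then have "s powr (a / 2) \<le> s powr (1 / 2)" using assms by (intro powr_mono) auto
  also have "\<dots> = sqrt s" using assms by (simp add: powr_half_sqrt)
  also have "\<dots> \<le> (1 + s) / 2" using arith_geo_mean_sqrt[of 1 s] assms by simp
  finally show ?thesis by simp
qed

lemma nn_integral_linear_exp: "(\<integral>\<^sup>+s. ennreal ((1 + s / 2) * exp (- s)) * indicator {0..} s \<partial>lborel) = 3 / 2"
proof -
  have "(\<integral>\<^sup>+s. ennreal ((1 + s / 2) * exp (- s)) * indicator {0..} s \<partial>lborel)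
      = 0 - (- (0 / 2 + 3 / 2) * exp (- 0 :: real))"
  proof (rule nn_integral_FTC_atLeast)
    show "((\<lambda>s. - (s / 2 + 3 / 2) * exp (- s :: real)) \<longlongrightarrow> 0) at_top" by real_asymp
    show "DERIV (\<lambda>s. - (s / 2 + 3 / 2) * exp (- s)) x :> (1 + x / 2) * exp (- x)" for x :: real
      by (auto intro!: derivative_eq_intros simp: field_simps)
  qed auto
  then show ?thesis by (simp add: ennreal_divide_numeral[symmetric] flip: ennreal_numeral)
qed

lemma exp_neg_eq_nn_integral:
  assumes "u \<ge> 0"
  shows "ennreal (exp (- u)) = (\<integral>\<^sup>+s. ennreal (exp (- s)) * indicator {u..} s \<partial>lborel)"
proof -
  have "(\<integral>\<^sup>+s. ennreal (exp (- s)) * indicator {u..} s \<partial>lborel) = 0 - (- exp (- u :: real))"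
  proof (rule nn_integral_FTC_atLeast)
    show "((\<lambda>s. - exp (- s :: real)) \<longlongrightarrow> 0) at_top" by real_asymp
    show "DERIV (\<lambda>s. - exp (- s)) x :> exp (- x)" for x :: real
      by (auto intro!: derivative_eq_intros)
  qed auto
  then show ?thesis by simp
qed

text \<open>
  Writing exp(-u) as the integral of exp(-s) over s \<ge> u turns the Laplace transform into a
  mixture of the probabilities P(|Y| \<le> sqrt(s/l)) \<le> C^\<alpha> l^(-\<alpha>/2) s^(\<alpha>/2). The exact constant
  would be Gamma(1 + \<alpha>/2); the bound s^(\<alpha>/2) \<le> 1 + s/2 replaces it by 3/2.
\<close>
lemma (in prob_space) laplace_transform_small_ball:
  fixes Y :: "'a \<Rightarrow> real"
  assumes [measurable]: "Y \<in> borel_measurable M"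
    and small: "\<And>t. t > 0 \<Longrightarrow> prob {\<omega>\<in>space M. \<bar>Y \<omega>\<bar> \<le> t} \<le> (C * t) powr \<alpha>"
    and \<alpha>: "0 < \<alpha>" "\<alpha> \<le> 1" and C: "C > 0" and l: "l > 0"
  shows "(\<integral>\<^sup>+\<omega>. ennreal (exp (- (l * (Y \<omega>)\<^sup>2))) \<partial>M) \<le> ennreal (3 / 2 * C powr \<alpha> * l powr (- \<alpha> / 2))"
proof -
  interpret P: pair_sigma_finite M "lborel :: real measure" ..
  let ?K = "C powr \<alpha> * l powr (- \<alpha> / 2)"
  have "(\<integral>\<^sup>+\<omega>. ennreal (exp (- (l * (Y \<omega>)\<^sup>2))) \<partial>M)
      = (\<integral>\<^sup>+\<omega>. (\<integral>\<^sup>+s. ennreal (exp (- s)) * indicator {l * (Y \<omega>)\<^sup>2..} s \<partial>lborel) \<partial>M)"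
    using l by (intro nn_integral_cong exp_neg_eq_nn_integral) auto
  also have "\<dots> = (\<integral>\<^sup>+s. (\<integral>\<^sup>+\<omega>. ennreal (exp (- s)) * indicator {l * (Y \<omega>)\<^sup>2..} s \<partial>M) \<partial>lborel)"
    by (rule P.Fubini'[symmetric]) (simp add: indicator_def[abs_def] atLeast_def, measurable)
  also have "\<dots> \<le> (\<integral>\<^sup>+s. ennreal ?K * (ennreal ((1 + s / 2) * exp (- s)) * indicator {0..} s) \<partial>lborel)"
  proof (rule nn_integral_mono_AE)
    have "AE s in lborel. s \<noteq> (0::real)" by (rule AE_lborel_singleton)
    then show "AE s in lborel. (\<integral>\<^sup>+\<omega>. ennreal (exp (- s)) * indicator {l * (Y \<omega>)\<^sup>2..} s \<partial>M)
        \<le> ennreal ?K * (ennreal ((1 + s / 2) * exp (- s)) * indicator {0..} s)"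
    proof eventually_elim
      fix s :: real assume "s \<noteq> 0"
      show "(\<integral>\<^sup>+\<omega>. ennreal (exp (- s)) * indicator {l * (Y \<omega>)\<^sup>2..} s \<partial>M)
        \<le> ennreal ?K * (ennreal ((1 + s / 2) * exp (- s)) * indicator {0..} s)"
      proof (cases "s > 0")
        case False
        with \<open>s \<noteq> 0\<close> have "s < 0" by simp
        have "\<not> l * (Y \<omega>)\<^sup>2 \<le> s" for \<omega>
          using \<open>s < 0\<close> l by (smt (verit) mult_nonneg_nonneg zero_le_power2)
        then show ?thesis by simp
      next
        case True
        have sq: "l * y\<^sup>2 \<le> s \<longleftrightarrow> \<bar>y\<bar> \<le> sqrt (s / l)" for y
        proof -
          have "l * y\<^sup>2 \<le> s \<longleftrightarrow> y\<^sup>2 \<le> s / l" using l by (simp add: field_simps)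
          also have "\<dots> \<longleftrightarrow> \<bar>y\<bar> \<le> sqrt (s / l)"
            by (metis real_sqrt_abs real_sqrt_le_iff)
          finally show ?thesis .
        qed
        have "(\<integral>\<^sup>+\<omega>. ennreal (exp (- s)) * indicator {l * (Y \<omega>)\<^sup>2..} s \<partial>M)
            = (\<integral>\<^sup>+\<omega>. ennreal (exp (- s)) * indicator {\<omega>\<in>space M. \<bar>Y \<omega>\<bar> \<le> sqrt (s / l)} \<omega> \<partial>M)"
          by (intro nn_integral_cong) (auto simp: sq split: split_indicator)
        also have "\<dots> = ennreal (exp (- s)) * ennreal (prob {\<omega>\<in>space M. \<bar>Y \<omega>\<bar> \<le> sqrt (s / l)})"
          by (simp add: nn_integral_cmult emeasure_eq_measure)
        also have "\<dots> \<le> ennreal (exp (- s)) * ennreal ((C * sqrt (s / l)) powr \<alpha>)"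
          using True l by (intro mult_left_mono ennreal_leI small) auto
        also have "(C * sqrt (s / l)) powr \<alpha> = ?K * s powr (\<alpha> / 2)"
          using True l C by (simp add: powr_mult powr_divide powr_half_sqrt[symmetric] powr_powr powr_minus_divide)
        also have "ennreal (exp (- s)) * ennreal (?K * s powr (\<alpha> / 2)) \<le> ennreal (exp (- s)) * ennreal (?K * (1 + s / 2))"
          using True \<alpha> by (intro mult_left_mono ennreal_leI powr_half_le_linear) auto
        also have "\<dots> = ennreal ?K * (ennreal ((1 + s / 2) * exp (- s)) * indicator {0..} s)"
          using True by (simp add: ennreal_mult[symmetric] mult_ac)
        finally show ?thesis .
      qed
    qed
  qed
  also have "\<dots> = ennreal ?K * (3 / 2)"
    by (subst nn_integral_cmult) (simp_all add: nn_integral_linear_exp)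
  also have "(3 / 2 :: ennreal) = ennreal (3 / 2)"
    by (simp add: ennreal_divide_numeral[symmetric] flip: ennreal_numeral)
  also have "ennreal ?K * ennreal (3 / 2) = ennreal (3 / 2 * C powr \<alpha> * l powr (- \<alpha> / 2))"
    by (simp add: ennreal_mult[symmetric] mult_ac)
  finally show ?thesis .
qed

section \<open>Independent copies and second moments\<close>

lemma iid_copies_measurable:
  assumes "prob_space M" "iid_copies M n Xs N X" "i \<in> {1..n}"
  shows "Xs i \<in> borel_measurable M"
  using assms by (auto simp: iid_copies_def prob_space.indep_vars_def)

text \<open>
  Independence in the form in which it is used twice: with f an exponential for the upper tail
  bound, and with f an indicator for the lower one.
\<close>
lemma iid_copies_nn_integral_prod:
  fixes f :: "real^'d \<Rightarrow> ennreal"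
  assumes M: "prob_space M" and iid: "iid_copies M n Xs N X"
    and X[measurable]: "X \<in> borel_measurable N" and f[measurable]: "f \<in> borel_measurable borel"
  shows "(\<integral>\<^sup>+\<omega>. (\<Prod>i=1..n. f (Xs i \<omega>)) \<partial>M) = (\<integral>\<^sup>+\<omega>. f (X \<omega>) \<partial>N) ^ n"
proof -
  interpret prob_space M by fact
  have ind: "indep_vars (\<lambda>_. borel) Xs {1..n}" using iid by (simp add: iid_copies_def)
  have "indep_vars (\<lambda>_. borel) (\<lambda>i \<omega>. f (Xs i \<omega>)) {1..n}"
    by (rule indep_vars_compose2[OF ind]) simp
  then have "(\<integral>\<^sup>+\<omega>. (\<Prod>i=1..n. f (Xs i \<omega>)) \<partial>M) = (\<Prod>i=1..n. \<integral>\<^sup>+\<omega>. f (Xs i \<omega>) \<partial>M)"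
    by (intro indep_vars_nn_integral) auto
  also have "\<dots> = (\<Prod>i=1..n. \<integral>\<^sup>+\<omega>. f (X \<omega>) \<partial>N)"
  proof (rule prod.cong[OF refl])
    fix i assume i: "i \<in> {1..n}"
    have [measurable]: "Xs i \<in> borel_measurable M" using iid_copies_measurable[OF M iid i] .
    have "(\<integral>\<^sup>+\<omega>. f (Xs i \<omega>) \<partial>M) = (\<integral>\<^sup>+x. f x \<partial>distr M borel (Xs i))"
      by (rule nn_integral_distr[symmetric]) auto
    also have "\<dots> = (\<integral>\<^sup>+x. f x \<partial>distr N borel X)" using iid i by (simp add: iid_copies_def)
    also have "\<dots> = (\<integral>\<^sup>+\<omega>. f (X \<omega>) \<partial>N)" by (rule nn_integral_distr) auto
    finally show "(\<integral>\<^sup>+\<omega>. f (Xs i \<omega>) \<partial>M) = (\<integral>\<^sup>+\<omega>. f (X \<omega>) \<partial>N)" .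
  qed
  finally show ?thesis by simp
qed

lemma identity_second_moment_coordinate:
  assumes "identity_second_moment N X"
  shows "has_bochner_integral N (\<lambda>\<omega>. (X \<omega> $ i)\<^sup>2) 1"
proof -
  have "has_bochner_integral N (\<lambda>\<omega>. outer (X \<omega>) $ i $ i) (mat 1 $ i $ i)"
    using assms unfolding identity_second_moment_def
    by (intro has_bochner_integral_bounded_linear[OF bounded_linear_vec_nth])
  then show ?thesis by (simp add: outer_def mat_def power2_eq_square)
qed

lemma identity_second_moment_norm_tail:
  fixes X :: "'b \<Rightarrow> real^'d"
  assumes "prob_space N" and [measurable]: "X \<in> borel_measurable N"
    and id: "identity_second_moment N X" and R: "R > 0"
  shows "measure N {\<omega>\<in>space N. norm (X \<omega>) > R} \<le> real CARD('d) / R\<^sup>2"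
proof -
  interpret prob_space N by fact
  have "has_bochner_integral N (\<lambda>\<omega>. \<Sum>i\<in>UNIV. (X \<omega> $ i)\<^sup>2) (\<Sum>i\<in>(UNIV::'d set). 1)"
    by (intro has_bochner_integral_sum identity_second_moment_coordinate id)
  then have *: "has_bochner_integral N (\<lambda>\<omega>. (norm (X \<omega>))\<^sup>2) (real CARD('d))"
    by (simp add: norm_vec_def L2_set_def sum_nonneg)
  have "{\<omega>\<in>space N. norm (X \<omega>) > R} \<subseteq> {\<omega>\<in>space N. R\<^sup>2 \<le> (norm (X \<omega>))\<^sup>2}"
    using R by (auto intro!: power_mono)
  then have "measure N {\<omega>\<in>space N. norm (X \<omega>) > R} \<le> measure N {\<omega>\<in>space N. R\<^sup>2 \<le> (norm (X \<omega>))\<^sup>2}"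
    by (intro finite_measure_mono) auto
  also have "\<dots> \<le> (\<integral>\<omega>. (norm (X \<omega>))\<^sup>2 \<partial>N) / R\<^sup>2"
    using R * by (intro integral_Markov_inequality_measure[where A="{}"]) (auto simp: has_bochner_integral_iff)
  finally show ?thesis using * by (simp add: has_bochner_integral_iff)
qed

text \<open>
  Large vectors are sent to 0 rather than projected onto the ball: then exp(-l (\<theta>.x)^2) changes
  only where |x| > R, and the truncation costs exactly the probability of this event.
\<close>
definition truncate_norm :: "real \<Rightarrow> 'a::real_normed_vector \<Rightarrow> 'a" where
  "truncate_norm R x = (if norm x \<le> R then x else 0)"

lemma truncate_norm_measurable [measurable]:
  "truncate_norm R \<in> borel_measurable (borel :: 'a::{real_normed_vector,second_countable_topology} measure)"
  unfolding truncate_norm_def[abs_def] by measurable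

lemma norm_truncate_norm_le: "R \<ge> 0 \<Longrightarrow> norm (truncate_norm R x) \<le> R"
  by (simp add: truncate_norm_def)

lemma inner_truncate_norm_sq_le: "(v \<bullet> truncate_norm R x)\<^sup>2 \<le> (v \<bullet> x)\<^sup>2"
  by (simp add: truncate_norm_def)

text \<open>
  The radius R is chosen so that the Markov bound d/R^2 for P(|X| > R) equals l^(-\<alpha>/2), the order
  of the Laplace transform itself.
\<close>
lemma laplace_transform_truncated:
  fixes X :: "'b \<Rightarrow> real^'d"
  assumes N: "prob_space N" and X[measurable]: "X \<in> borel_measurable N"
    and id: "identity_second_moment N X"
    and C: "C \<ge> 1" and \<alpha>: "0 < \<alpha>" "\<alpha> \<le> 1" and l: "l > 0"
    and small: "\<forall>\<theta>\<in>sphere 0 1. \<forall>t>0. \<P>(\<omega> in N. \<bar>\<theta> \<bullet> X \<omega>\<bar> \<le> t) \<le> (C * t) powr \<alpha>"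
    and \<theta>: "norm \<theta> \<ge> 1" and R: "R > 0" "R\<^sup>2 = real CARD('d) * l powr (\<alpha> / 2)"
  shows "(\<integral>\<^sup>+\<omega>. ennreal (exp (- (l * (\<theta> \<bullet> truncate_norm R (X \<omega>))\<^sup>2))) \<partial>N)
    \<le> ennreal (5 / 2 * C powr \<alpha> * l powr (- \<alpha> / 2))"
proof -
  interpret prob_space N by fact
  have "\<theta> \<noteq> 0" using \<theta> by auto
  have ball: "prob {\<omega>\<in>space N. \<bar>\<theta> \<bullet> X \<omega>\<bar> \<le> t} \<le> (C * t) powr \<alpha>" if "t > 0" for t
  proof -
    have "\<bar>sgn \<theta> \<bullet> x\<bar> \<le> \<bar>\<theta> \<bullet> x\<bar>" for x
    proof -
      have "\<bar>sgn \<theta> \<bullet> x\<bar> = \<bar>\<theta> \<bullet> x\<bar> / norm \<theta>"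
        by (simp add: sgn_div_norm abs_mult divide_inverse mult.commute)
      also have "\<dots> \<le> \<bar>\<theta> \<bullet> x\<bar> / 1" using \<theta> by (intro divide_left_mono) auto
      finally show ?thesis by simp
    qed
    then have "prob {\<omega>\<in>space N. \<bar>\<theta> \<bullet> X \<omega>\<bar> \<le> t} \<le> prob {\<omega>\<in>space N. \<bar>sgn \<theta> \<bullet> X \<omega>\<bar> \<le> t}"
      by (intro finite_measure_mono) (auto intro: order_trans)
    also have "\<dots> \<le> (C * t) powr \<alpha>"
      using small that \<open>\<theta> \<noteq> 0\<close> by (simp add: norm_sgn)
    finally show ?thesis .
  qed
  let ?K = "C powr \<alpha> * l powr (- \<alpha> / 2)"
  let ?big = "{\<omega>\<in>space N. norm (X \<omega>) > R}"
  have "(\<integral>\<^sup>+\<omega>. ennreal (exp (- (l * (\<theta> \<bullet> truncate_norm R (X \<omega>))\<^sup>2))) \<partial>N)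
      \<le> (\<integral>\<^sup>+\<omega>. ennreal (exp (- (l * (\<theta> \<bullet> X \<omega>)\<^sup>2))) + indicator ?big \<omega> \<partial>N)"
    by (intro nn_integral_mono) (auto simp: truncate_norm_def)
  also have "\<dots> = (\<integral>\<^sup>+\<omega>. ennreal (exp (- (l * (\<theta> \<bullet> X \<omega>)\<^sup>2))) \<partial>N) + emeasure N ?big"
    by (subst nn_integral_add) auto
  also have "\<dots> \<le> ennreal (3 / 2 * C powr \<alpha> * l powr (- \<alpha> / 2)) + ennreal (real CARD('d) / R\<^sup>2)"
    using C identity_second_moment_norm_tail[OF N X id R(1)]
    by (intro add_mono laplace_transform_small_ball ball \<alpha> l) (auto simp: emeasure_eq_measure)
  also have "\<dots> = ennreal (3 / 2 * C powr \<alpha> * l powr (- \<alpha> / 2) + real CARD('d) / R\<^sup>2)"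
    by (rule ennreal_plus[symmetric]) auto
  also have "\<dots> \<le> ennreal (5 / 2 * C powr \<alpha> * l powr (- \<alpha> / 2))"
  proof (rule ennreal_leI)
    have "real CARD('d) / R\<^sup>2 = l powr (- \<alpha> / 2)"
      unfolding R(2) by (simp add: powr_minus_divide)
    also have "\<dots> \<le> ?K" using ge_one_powr_ge_zero[of C \<alpha>] C \<alpha> l by simp
    finally show "3 / 2 * C powr \<alpha> * l powr (- \<alpha> / 2) + real CARD('d) / R\<^sup>2
        \<le> 5 / 2 * C powr \<alpha> * l powr (- \<alpha> / 2)" unfolding mult.assoc by linarith
  qed
  finally show ?thesis .
qed

section \<open>The lower tail of the smallest eigenvalue\<close>

text \<open>
  With all factors written as exponentials, c = ln C, L = ln l and m = 4c + 1 + 9/\<alpha>, the claim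
  per observation is, up to the small terms in r, that 3 + \<alpha>c - 3\<alpha>L/8 is at most
  \<alpha>m/6 - \<alpha>L/6. Since L \<ge> m, it suffices that 3 + \<alpha>c \<le> 3\<alpha>m/8. The right-hand side is
  at least 3\<alpha>c/2 + 27/8, and the remaining 3/8 pays for the terms in r \<le> 1/16.
\<close>
lemma lower_tail_constant_bound:
  fixes C \<alpha> l r :: real and d n :: nat
  assumes C: "C \<ge> 1" and \<alpha>: "0 < \<alpha>" "\<alpha> \<le> 1" and dn: "real d \<le> \<alpha> * real n / 6"
    and l: "l \<ge> 3 * C ^ 4 * exp (1 + 9 / \<alpha>)" and r_def: "r = l powr (- (1 / 2 + \<alpha> / 4))"
  shows "((1 + 2 * r) / r) ^ d * (5 / 2 * C powr \<alpha> * l powr (- \<alpha> / 2) * exp ((1 + r)\<^sup>2 + 1)) ^ n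
    \<le> (3 * C ^ 4 * exp (1 + 9 / \<alpha>) / l) powr (\<alpha> * real n / 6)"
proof -
  define c L m where "c = ln C" and "L = ln l" and "m = 4 * c + 1 + 9 / \<alpha>"
  have c0: "c \<ge> 0" unfolding c_def using C by simp
  have Cexp: "C = exp c" using C by (simp add: c_def)
  have C4: "C ^ 4 * exp (1 + 9 / \<alpha>) = exp m"
    unfolding m_def Cexp by (simp add: exp_of_nat_mult[symmetric] exp_add[symmetric])
  have lm: "exp m \<le> l" using l exp_gt_zero[of m] unfolding C4 mult.assoc by linarith
  have lpos: "l > 0" using lm exp_gt_zero[of m] by linarith
  have lexp: "l = exp L" using lpos by (simp add: L_def)
  have mL: "m \<le> L" using lm by (simp add: lexp)
  have "9 / \<alpha> \<ge> 9" using \<alpha> by (simp add: field_simps)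
  then have m10: "m \<ge> 10" using c0 by (simp add: m_def)
  have rexp: "r = exp (- ((1 / 2 + \<alpha> / 4) * L))" by (simp add: r_def lexp exp_powr_real algebra_simps)
  have rpos: "r > 0" by (simp add: rexp)
  have r16: "r \<le> 1 / 16"
  proof -
    have "1 / 2 * 10 \<le> (1 / 2 + \<alpha> / 4) * L" using m10 mL \<alpha> by (intro mult_mono) auto
    then have "r \<le> exp (- 5)" by (simp add: rexp)
    also have "\<dots> \<le> 1 / 16"
    proof -
      have "exp (5::real) \<ge> 16" using exp_lower_Taylor_quadratic[of 5] by simp
      then have "inverse (exp (5::real)) \<le> inverse 16" by (intro le_imp_inverse_le) auto
      then show ?thesis by (simp add: exp_minus)
    qed
    finally show ?thesis .
  qed
  have f1: "(1 + 2 * r) / r \<le> exp (2 * r + (1 / 2 + \<alpha> / 4) * L)"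
  proof -
    have "(1 + 2 * r) / r = (1 + 2 * r) * exp ((1 / 2 + \<alpha> / 4) * L)"
      by (simp add: rexp exp_minus field_simps)
    also have "\<dots> \<le> exp (2 * r) * exp ((1 / 2 + \<alpha> / 4) * L)"
      by (intro mult_right_mono exp_ge_add_one_self) auto
    finally show ?thesis by (simp add: exp_add)
  qed
  have f2: "5 / 2 * C powr \<alpha> * l powr (- \<alpha> / 2) * exp ((1 + r)\<^sup>2 + 1) \<le> exp (1 + \<alpha> * c - \<alpha> / 2 * L + ((1 + r)\<^sup>2 + 1))"
  proof -
    have "5 / 2 \<le> exp (1::real)" using exp_lower_Taylor_quadratic[of 1] by simp
    then have "5 / 2 * (C powr \<alpha> * l powr (- \<alpha> / 2) * exp ((1 + r)\<^sup>2 + 1))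
        \<le> exp 1 * (C powr \<alpha> * l powr (- \<alpha> / 2) * exp ((1 + r)\<^sup>2 + 1))"
      by (intro mult_right_mono) auto
    also have "\<dots> = exp (1 + \<alpha> * c - \<alpha> / 2 * L + ((1 + r)\<^sup>2 + 1))"
      by (simp add: Cexp lexp exp_powr_real exp_add[symmetric] algebra_simps)
    finally show ?thesis by (simp add: mult.assoc)
  qed
  have L0: "L \<ge> 0" using mL m10 by simp
  have key: "\<alpha> / 6 * (2 * r + (1 / 2 + \<alpha> / 4) * L) + (1 + \<alpha> * c - \<alpha> / 2 * L + ((1 + r)\<^sup>2 + 1)) \<le> \<alpha> / 6 * (m - L)"
  proof -
    have a: "\<alpha> / 6 * (2 * r) \<le> 1 / 6 * (2 / 16)" using \<alpha> r16 rpos by (intro mult_mono) auto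
    have "(1 / 2 + \<alpha> / 4) * L \<le> 3 / 4 * L" using \<alpha> L0 by (intro mult_right_mono) auto
    then have b: "\<alpha> / 6 * ((1 / 2 + \<alpha> / 4) * L) \<le> \<alpha> / 6 * (3 / 4 * L)" using \<alpha> by (intro mult_left_mono) auto
    have e: "(1 + r)\<^sup>2 \<le> (17 / 16)\<^sup>2" using rpos r16 by (intro power_mono) auto
    have f: "\<alpha> * (4 * c + 9 / \<alpha>) \<le> \<alpha> * m" using \<alpha> by (intro mult_left_mono) (auto simp: m_def)
    have g: "\<alpha> * m \<le> \<alpha> * L" using \<alpha> mL by (intro mult_left_mono) auto
    have h: "\<alpha> * (4 * c + 9 / \<alpha>) = 4 * (\<alpha> * c) + 9" using \<alpha> by (simp add: field_simps)
    have k: "\<alpha> * c \<ge> 0" using \<alpha> c0 by simp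
    have "\<alpha> / 6 * (2 * r + (1 / 2 + \<alpha> / 4) * L) + (1 + \<alpha> * c - \<alpha> / 2 * L + ((1 + r)\<^sup>2 + 1))
       \<le> 1 / 48 + (\<alpha> * L) / 8 + 2 + \<alpha> * c - (\<alpha> * L) / 2 + 289 / 256"
      using a b e by (simp add: algebra_simps power2_eq_square)
    also have "\<dots> \<le> (\<alpha> * m) / 6 - (\<alpha> * L) / 6" using f g h k by (simp add: field_simps)
    also have "\<dots> = \<alpha> / 6 * (m - L)" by (simp add: algebra_simps)
    finally show ?thesis .
  qed
  have "((1 + 2 * r) / r) ^ d * (5 / 2 * C powr \<alpha> * l powr (- \<alpha> / 2) * exp ((1 + r)\<^sup>2 + 1)) ^ n
     \<le> exp (2 * r + (1 / 2 + \<alpha> / 4) * L) ^ d * exp (1 + \<alpha> * c - \<alpha> / 2 * L + ((1 + r)\<^sup>2 + 1)) ^ n"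
    using rpos by (intro mult_mono power_mono f1 f2) auto
  also have "\<dots> = exp (real d * (2 * r + (1 / 2 + \<alpha> / 4) * L) + real n * (1 + \<alpha> * c - \<alpha> / 2 * L + ((1 + r)\<^sup>2 + 1)))"
    by (simp add: exp_of_nat_mult[symmetric] exp_add[symmetric])
  also have "\<dots> \<le> exp ((\<alpha> * real n / 6) * (2 * r + (1 / 2 + \<alpha> / 4) * L) + real n * (1 + \<alpha> * c - \<alpha> / 2 * L + ((1 + r)\<^sup>2 + 1)))"
    unfolding exp_le_cancel_iff using dn L0 rpos \<alpha> by (intro add_right_mono mult_right_mono) auto
  also have "\<dots> = exp (real n * (\<alpha> / 6 * (2 * r + (1 / 2 + \<alpha> / 4) * L) + (1 + \<alpha> * c - \<alpha> / 2 * L + ((1 + r)\<^sup>2 + 1))))"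
    by (simp add: algebra_simps)
  also have "\<dots> \<le> exp (real n * (\<alpha> / 6 * (m - L)))"
    unfolding exp_le_cancel_iff by (intro mult_left_mono key) auto
  also have "\<dots> = (exp m / l) powr (\<alpha> * real n / 6)"
    by (simp add: lexp exp_diff[symmetric] exp_powr_real algebra_simps)
  also have "\<dots> \<le> (3 * C ^ 4 * exp (1 + 9 / \<alpha>) / l) powr (\<alpha> * real n / 6)"
    using \<alpha> lpos C4 by (intro powr_mono2 divide_right_mono) (auto simp: mult.assoc)
  finally show ?thesis .
qed

text \<open>
  The expected integral of the Laplace functional g over the shell A is bounded above by Fubini's
  theorem and independence, and below by restricting to the event E and to a ball inside A.
  Comparing the two bounds gives the probability of E; the unit ball volume V cancels.
\<close>
theorem lambda_min_lower_tail:
  fixes M :: "'a measure" and N :: "'b measure"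
    and X :: "'b \<Rightarrow> real^'d" and Xs :: "nat \<Rightarrow> 'a \<Rightarrow> real^'d"
  assumes N: "prob_space N" and X[measurable]: "X \<in> borel_measurable N"
    and M: "prob_space M" and n: "n \<ge> 1" and iid: "iid_copies M n Xs N X"
    and id: "identity_second_moment N X"
    and C: "C \<ge> 1" and \<alpha>: "0 < \<alpha>" "\<alpha> \<le> 1" and dn: "real n \<ge> 6 * real CARD('d) / \<alpha>"
    and small: "\<forall>\<theta>\<in>sphere 0 1. \<forall>t>0. \<P>(\<omega> in N. \<bar>\<theta> \<bullet> X \<omega>\<bar> \<le> t) \<le> (C * t) powr \<alpha>"
    and t: "t > 0"
  shows "\<P>(\<omega> in M. lambda_min (sample_cov n Xs \<omega>) \<le> t)
    \<le> (3 * C ^ 4 * exp (1 + 9 / \<alpha>) * t) powr (\<alpha> * real n / 6)"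
proof (cases "3 * C ^ 4 * exp (1 + 9 / \<alpha>) * t \<ge> 1")
  case True
  then have "1 \<le> (3 * C ^ 4 * exp (1 + 9 / \<alpha>) * t) powr (\<alpha> * real n / 6)"
    using \<alpha> by (intro ge_one_powr_ge_zero) auto
  then show ?thesis using prob_space.prob_le_1[OF M] order_trans by blast
next
  case False
  interpret M: prob_space M by fact
  interpret P: pair_sigma_finite M "lborel :: (real^'d) measure" ..
  let ?d = "CARD('d)"
  define l R r where "l = 1 / t" and "R = sqrt (real ?d * l powr (\<alpha> / 2))"
    and "r = l powr (- (1 / 2 + \<alpha> / 4))"
  have l: "l > 0" "l \<ge> 3 * C ^ 4 * exp (1 + 9 / \<alpha>)"
    using False t by (auto simp: l_def field_simps)
  have R: "R > 0" "R\<^sup>2 = real ?d * l powr (\<alpha> / 2)"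
    using l by (auto simp: R_def)
  have r: "r > 0" using l by (simp add: r_def)
  \<comment> \<open>The radius r makes the trace term of the averaged quadratic form cost a factor e per
    observation.\<close>
  have rR: "r\<^sup>2 * (l * R\<^sup>2) = real ?d"
  proof -
    have "r\<^sup>2 * (l * l powr (\<alpha> / 2)) = l powr (- (1 / 2 + \<alpha> / 4) + - (1 / 2 + \<alpha> / 4) + (1 + \<alpha> / 2))"
      using l by (simp only: r_def power2_eq_square powr_add powr_one mult.assoc less_imp_le)
    also have "\<dots> = 1" using l by simp
    finally show ?thesis by (simp add: R(2))
  qed
  define B where "B = 5 / 2 * C powr \<alpha> * l powr (- \<alpha> / 2)"
  have B: "B \<ge> 0" unfolding B_def by simp
  define x where "x i \<omega> = sqrt l *\<^sub>R truncate_norm R (Xs i \<omega>)" for i \<omega>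
  have [measurable]: "Xs i \<in> borel_measurable M" if "i \<in> {1..n}" for i
    using iid_copies_measurable[OF M iid that] .
  have x_inner: "(\<theta> \<bullet> x i \<omega>)\<^sup>2 = l * (\<theta> \<bullet> truncate_norm R (Xs i \<omega>))\<^sup>2" for \<theta> i \<omega>
    using l by (simp add: x_def power_mult_distrib)
  define g where "g \<omega> \<theta> = ennreal (exp (- (\<Sum>i=1..n. (\<theta> \<bullet> x i \<omega>)\<^sup>2)))" for \<omega> and \<theta> :: "real^'d"
  have g_prod: "g \<omega> \<theta> = (\<Prod>i=1..n. ennreal (exp (- (l * (\<theta> \<bullet> truncate_norm R (Xs i \<omega>))\<^sup>2))))" for \<omega> \<theta>
    by (simp add: g_def exp_sum sum_negf[symmetric] prod_ennreal x_inner)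
  have g_meas[measurable]: "(\<lambda>(\<omega>, \<theta>). g \<omega> \<theta>) \<in> borel_measurable (M \<Otimes>\<^sub>M lborel)"
    unfolding g_prod case_prod_beta by measurable
  define A where "A = {\<theta>::real^'d. 1 \<le> norm \<theta> \<and> norm \<theta> \<le> 1 + 2 * r}"
  have [measurable]: "A \<in> sets borel" unfolding A_def by measurable
  define E where "E = {\<omega>\<in>space M. lambda_min (sample_cov n Xs \<omega>) \<le> t}"
  have [measurable]: "(\<lambda>\<omega>. lambda_min (sample_cov n Xs \<omega>)) \<in> borel_measurable M"
    using iid_copies_measurable[OF M iid] by (rule lambda_min_sample_cov_measurable)
  have [measurable]: "E \<in> sets M" unfolding E_def by measurable
  define V where "V = unit_ball_vol (real ?d)"
  have V: "V > 0" unfolding V_def by simp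
  have "(\<integral>\<^sup>+\<omega>. (\<integral>\<^sup>+\<theta>. indicator A \<theta> * g \<omega> \<theta> \<partial>lborel) \<partial>M) = (\<integral>\<^sup>+\<theta>. (\<integral>\<^sup>+\<omega>. indicator A \<theta> * g \<omega> \<theta> \<partial>M) \<partial>lborel)"
    by (rule P.Fubini'[symmetric]) measurable
  also have "\<dots> \<le> (\<integral>\<^sup>+\<theta>. ennreal (B ^ n) * indicator A \<theta> \<partial>lborel)"
  proof (rule nn_integral_mono)
    fix \<theta> :: "real^'d"
    show "(\<integral>\<^sup>+\<omega>. indicator A \<theta> * g \<omega> \<theta> \<partial>M) \<le> ennreal (B ^ n) * indicator A \<theta>"
    proof (cases "\<theta> \<in> A")
      case True
      then have "norm \<theta> \<ge> 1" by (simp add: A_def)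
      have "(\<integral>\<^sup>+\<omega>. indicator A \<theta> * g \<omega> \<theta> \<partial>M)
          = (\<integral>\<^sup>+\<omega>. ennreal (exp (- (l * (\<theta> \<bullet> truncate_norm R (X \<omega>))\<^sup>2))) \<partial>N) ^ n"
        using True unfolding g_prod
        by (subst iid_copies_nn_integral_prod[OF M iid X, symmetric]) auto
      also have "\<dots> \<le> ennreal B ^ n"
        unfolding B_def
        by (intro power_mono laplace_transform_truncated[OF N X id C \<alpha> l(1) small \<open>norm \<theta> \<ge> 1\<close> R]) auto
      finally show ?thesis using True B by (simp add: ennreal_power)
    qed simp
  qed
  also have "\<dots> = ennreal (B ^ n) * emeasure lborel A"
    by (simp add: nn_integral_cmult)
  also have "\<dots> \<le> ennreal (B ^ n) * emeasure lborel (cball (0::real^'d) (1 + 2 * r))"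
    by (intro mult_left_mono emeasure_mono) (auto simp: A_def)
  also have "\<dots> = ennreal (B ^ n * (V * (1 + 2 * r) ^ ?d))"
    using r B V by (simp add: emeasure_cball V_def ennreal_mult)
  finally have upper: "(\<integral>\<^sup>+\<omega>. (\<integral>\<^sup>+\<theta>. indicator A \<theta> * g \<omega> \<theta> \<partial>lborel) \<partial>M) \<le> ennreal (B ^ n * (V * (1 + 2 * r) ^ ?d))" .
  define c where "c = V * r ^ ?d * exp (- (real n * ((1 + r)\<^sup>2 + 1)))"
  have c: "c > 0" unfolding c_def using V r by simp
  have lower: "ennreal c \<le> (\<integral>\<^sup>+\<theta>. indicator A \<theta> * g \<omega> \<theta> \<partial>lborel)" if "\<omega> \<in> E" for \<omega>
  proof -
    obtain v where v: "norm v = 1" "lambda_min (sample_cov n Xs \<omega>) = (\<Sum>i=1..n. (v \<bullet> Xs i \<omega>)\<^sup>2) / real n"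
      by (rule lambda_min_sample_cov_attained)
    have vt: "(\<Sum>i=1..n. (v \<bullet> Xs i \<omega>)\<^sup>2) \<le> real n * t"
      using that v(2) n by (simp add: E_def field_simps)
    \<comment> \<open>Scaling v outwards keeps the ball about w out of the open unit ball, on which the bound
      for the Laplace transform fails.\<close>
    define w where "w = (1 + r) *\<^sub>R v"
    have sub: "cball w r \<subseteq> A"
    proof
      fix \<theta> assume "\<theta> \<in> cball w r"
      then have "norm (w - \<theta>) \<le> r" by (simp add: dist_norm)
      moreover have "norm w = 1 + r" using r v(1) by (simp add: w_def)
      moreover have "norm w \<le> norm \<theta> + norm (w - \<theta>)" "norm \<theta> \<le> norm w + norm (w - \<theta>)"
        by (metis add.commute diff_add_cancel norm_triangle_ineq) (metis norm_triangle_sub norm_minus_commute)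
      ultimately show "\<theta> \<in> A" by (simp add: A_def)
    qed
    have q1: "(\<Sum>i=1..n. (w \<bullet> x i \<omega>)\<^sup>2) \<le> real n * (1 + r)\<^sup>2"
    proof -
      have "(\<Sum>i=1..n. (w \<bullet> x i \<omega>)\<^sup>2) = (1 + r)\<^sup>2 * l * (\<Sum>i=1..n. (v \<bullet> truncate_norm R (Xs i \<omega>))\<^sup>2)"
        by (simp add: x_inner w_def power_mult_distrib sum_distrib_left mult_ac)
      also have "\<dots> \<le> (1 + r)\<^sup>2 * l * (\<Sum>i=1..n. (v \<bullet> Xs i \<omega>)\<^sup>2)"
        using l by (intro mult_left_mono sum_mono inner_truncate_norm_sq_le) auto
      also have "\<dots> \<le> (1 + r)\<^sup>2 * l * (real n * t)"
        using l vt by (intro mult_left_mono) auto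
      also have "\<dots> = real n * (1 + r)\<^sup>2" using t by (simp add: l_def)
      finally show ?thesis .
    qed
    have q2: "r\<^sup>2 * (\<Sum>i=1..n. (norm (x i \<omega>))\<^sup>2) / real ?d \<le> real n"
    proof -
      have "(norm (x i \<omega>))\<^sup>2 \<le> l * R\<^sup>2" for i
        using l R(1) norm_truncate_norm_le[of R "Xs i \<omega>"]
        by (auto simp: x_def power_mult_distrib intro!: power_mono)
      then have "(\<Sum>i=1..n. (norm (x i \<omega>))\<^sup>2) \<le> real n * (l * R\<^sup>2)"
        using sum_bounded_above[of "{1..n}" "\<lambda>i. (norm (x i \<omega>))\<^sup>2" "l * R\<^sup>2"] by simp
      then have "r\<^sup>2 * (\<Sum>i=1..n. (norm (x i \<omega>))\<^sup>2) \<le> r\<^sup>2 * (real n * (l * R\<^sup>2))"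
        by (intro mult_left_mono) auto
      also have "\<dots> = real n * real ?d" using rR by (metis mult.left_commute)
      finally show ?thesis by (simp add: field_simps)
    qed
    have "c \<le> measure lborel (cball (0::real^'d) r)
        * exp (- ((\<Sum>i=1..n. (w \<bullet> x i \<omega>)\<^sup>2) + r\<^sup>2 * (\<Sum>i=1..n. (norm (x i \<omega>))\<^sup>2) / DIM(real^'d)))"
      using q1 q2 r V by (simp add: c_def content_cball V_def[symmetric] algebra_simps)
    then have "ennreal c \<le> (\<integral>\<^sup>+\<theta>. indicator (cball w r) \<theta> * g \<omega> \<theta> \<partial>lborel)"
      unfolding g_def using exp_neg_sum_squares_cball_ge[where r=r and I="{1..n}" and w=w and x="\<lambda>i. x i \<omega>"]
      by (meson ennreal_leI order_trans)
    also have "\<dots> \<le> (\<integral>\<^sup>+\<theta>. indicator A \<theta> * g \<omega> \<theta> \<partial>lborel)"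
      using sub by (intro nn_integral_mono) (auto split: split_indicator)
    finally show ?thesis .
  qed
  have "ennreal (c * measure M E) = (\<integral>\<^sup>+\<omega>. ennreal c * indicator E \<omega> \<partial>M)"
    using c by (simp add: nn_integral_cmult M.emeasure_eq_measure ennreal_mult)
  also have "\<dots> \<le> (\<integral>\<^sup>+\<omega>. (\<integral>\<^sup>+\<theta>. indicator A \<theta> * g \<omega> \<theta> \<partial>lborel) \<partial>M)"
    using lower by (intro nn_integral_mono) (auto split: split_indicator)
  also note upper
  finally have "c * measure M E \<le> B ^ n * (V * (1 + 2 * r) ^ ?d)"
    using B V r by (subst (asm) ennreal_le_iff) auto
  then have "measure M E \<le> B ^ n * (V * (1 + 2 * r) ^ ?d) / c"
    using c by (simp add: field_simps)
  also have "\<dots> = ((1 + 2 * r) / r) ^ ?d * (B * exp ((1 + r)\<^sup>2 + 1)) ^ n"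
  proof -
    define e where "e = exp ((1 + r)\<^sup>2 + 1)"
    have ce: "c = V * r ^ ?d / e ^ n"
      by (simp only: c_def e_def exp_minus divide_inverse exp_of_nat_mult)
    have "e > 0" by (simp add: e_def)
    then show ?thesis
      unfolding e_def[symmetric] ce using V r by (simp add: field_simps power_divide power_mult_distrib)
  qed
  also have "\<dots> \<le> (3 * C ^ 4 * exp (1 + 9 / \<alpha>) / l) powr (\<alpha> * real n / 6)"
    unfolding B_def using dn \<alpha> by (intro lower_tail_constant_bound C l r_def) (auto simp: field_simps)
  finally show ?thesis by (simp add: E_def l_def)
qed

section \<open>Tail bounds and moments of the inverse eigenvalue\<close>

text \<open>
  The layer-cake formula, with 1 for the levels below 1 and the integral of 1/s^2 for those
  above.
\<close>
lemma (in prob_space) nn_integral_max_one_le_two: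
  fixes Z :: "'a \<Rightarrow> ennreal"
  assumes [measurable]: "Z \<in> borel_measurable M"
    and tail: "\<And>s. s \<ge> 1 \<Longrightarrow> emeasure M {\<omega>\<in>space M. ennreal s \<le> Z \<omega>} \<le> ennreal (1 / s\<^sup>2)"
  shows "(\<integral>\<^sup>+\<omega>. max 1 (Z \<omega>) \<partial>M) \<le> 2"
proof -
  interpret P: pair_sigma_finite M "lborel :: real measure" ..
  have layer: "max 1 z \<le> 1 + (\<integral>\<^sup>+s. indicator {s. 1 \<le> s \<and> ennreal s \<le> z} s \<partial>lborel)" for z
  proof (cases z)
    case (real y)
    show ?thesis
    proof (cases "y \<ge> 1")
      case True
      have "{s. 1 \<le> s \<and> ennreal s \<le> z} = {1..y}"
        using real by (auto simp: ennreal_le_iff)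
      then show ?thesis using real True
        by (simp add: max_def ennreal_1[symmetric] ennreal_plus[symmetric] del: ennreal_1 ennreal_plus)
    next
      case False
      then have "z \<le> 1" using real by (metis ennreal_le_1 linear)
      then show ?thesis by (simp add: max_def)
    qed
  next
    case top
    then have "{s. 1 \<le> s \<and> ennreal s \<le> z} = {1::real..}" by auto
    have "y \<le> emeasure lborel {1::real..}" for y :: nat
    proof -
      have "y = emeasure lborel {1..1 + real y}" by (simp add: ennreal_of_nat_eq_real_of_nat)
      also have "\<dots> \<le> emeasure lborel {1::real..}" by (intro emeasure_mono) auto
      finally show ?thesis .
    qed
    then have "emeasure lborel {1::real..} = \<infinity>"
      by (metis ennreal_of_nat_neq_top ennreal_Ex_less_of_nat infinity_ennreal_def leD top.not_eq_extremum)
    then show ?thesis using \<open>{s. 1 \<le> s \<and> ennreal s \<le> z} = {1::real..}\<close> by simp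
  qed
  have "(\<integral>\<^sup>+\<omega>. max 1 (Z \<omega>) \<partial>M) \<le> (\<integral>\<^sup>+\<omega>. 1 + (\<integral>\<^sup>+s. indicator {s. 1 \<le> s \<and> ennreal s \<le> Z \<omega>} s \<partial>lborel) \<partial>M)"
    by (intro nn_integral_mono layer)
  also have "\<dots> = 1 + (\<integral>\<^sup>+\<omega>. (\<integral>\<^sup>+s. indicator {s. 1 \<le> s \<and> ennreal s \<le> Z \<omega>} s \<partial>lborel) \<partial>M)"
    by (subst nn_integral_add) (simp_all add: indicator_def[abs_def] emeasure_space_1)
  also have "(\<integral>\<^sup>+\<omega>. (\<integral>\<^sup>+s. indicator {s. 1 \<le> s \<and> ennreal s \<le> Z \<omega>} s \<partial>lborel) \<partial>M)
      = (\<integral>\<^sup>+s. (\<integral>\<^sup>+\<omega>. indicator {s. 1 \<le> s \<and> ennreal s \<le> Z \<omega>} s \<partial>M) \<partial>lborel)"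
    by (rule P.Fubini'[symmetric]) (simp add: indicator_def[abs_def])
  also have "\<dots> \<le> (\<integral>\<^sup>+s. ennreal (1 / s\<^sup>2) * indicator {1..} s \<partial>lborel)"
  proof (rule nn_integral_mono)
    fix s :: real
    show "(\<integral>\<^sup>+\<omega>. indicator {s. 1 \<le> s \<and> ennreal s \<le> Z \<omega>} s \<partial>M) \<le> ennreal (1 / s\<^sup>2) * indicator {1..} s"
    proof (cases "s \<ge> 1")
      case True
      then have "(\<integral>\<^sup>+\<omega>. indicator {s. 1 \<le> s \<and> ennreal s \<le> Z \<omega>} s \<partial>M)
        = (\<integral>\<^sup>+\<omega>. indicator {\<omega>\<in>space M. ennreal s \<le> Z \<omega>} \<omega> \<partial>M)"
        by (intro nn_integral_cong) (auto split: split_indicator)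
      also have "\<dots> = emeasure M {\<omega>\<in>space M. ennreal s \<le> Z \<omega>}" by simp
      finally show ?thesis using tail[OF True] True by simp
    qed simp
  qed
  also have "\<dots> = ennreal (0 - (- 1 / 1))"
  proof (rule nn_integral_FTC_atLeast[where F="\<lambda>s. - 1 / s"])
    show "((\<lambda>s. - 1 / s :: real) \<longlongrightarrow> 0) at_top" by real_asymp
    show "DERIV (\<lambda>s. - 1 / s) x :> 1 / x\<^sup>2" if "1 \<le> x" for x :: real
      using that by (auto intro!: derivative_eq_intros simp: power2_eq_square)
  qed auto
  finally show ?thesis by simp
qed

lemma ennreal_powr_ennreal: "a \<ge> 0 \<Longrightarrow> ennreal_powr (ennreal a) r = ennreal (a powr r)"
  by (simp add: ennreal_powr_def)

lemma ennreal_powr_mono: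
  assumes "x \<le> y" "r > 0"
  shows "ennreal_powr x r \<le> ennreal_powr y r"
  using assms by (cases x; cases y) (auto simp: ennreal_powr_def top_unique intro!: ennreal_leI powr_mono2)

lemma ennreal_powr_measurable [measurable]: "(\<lambda>x. ennreal_powr x r) \<in> borel_measurable borel"
  unfolding ennreal_powr_def[abs_def] by measurable

lemma inv_lambda_min_measurable:
  assumes "(\<lambda>\<omega>. lambda_min (sample_cov n Xs \<omega>)) \<in> borel_measurable M"
  shows "inv_lambda_min n Xs \<in> borel_measurable M"
  unfolding inv_lambda_min_def[abs_def] using assms by measurable

lemma inv_lambda_min_ge:
  assumes "lambda_min (sample_cov n Xs \<omega>) \<le> t" "t > 0"
  shows "ennreal (1 / t) \<le> inv_lambda_min n Xs \<omega>"
proof -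
  show ?thesis
  proof (cases "lambda_min (sample_cov n Xs \<omega>) = 0")
    case True
    then show ?thesis by (simp add: inv_lambda_min_def)
  next
    case False
    then have "lambda_min (sample_cov n Xs \<omega>) > 0" using lambda_min_sample_cov_nonneg[of n Xs \<omega>] by simp
    then show ?thesis using assms
      by (auto simp: inv_lambda_min_def inverse_ennreal inverse_eq_divide intro!: ennreal_leI divide_left_mono)
  qed
qed

text \<open>
  With T the inverse eigenvalue, Z = (T/K)^q has tail at most s^(-p/q) \<le> s^(-2) for s \<ge> 1, so
  max(1, Z) has mean at most 2; and max(1, T)^q \<le> K^q max(1, Z).
\<close>
lemma Lq_norm_inv_lambda_min_le:
  assumes M: "prob_space M"
    and meas[measurable]: "(\<lambda>\<omega>. lambda_min (sample_cov n Xs \<omega>)) \<in> borel_measurable M"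
    and K: "K \<ge> 1" and q: "q > 0" "2 * q \<le> p"
    and tail: "\<And>t. t > 0 \<Longrightarrow> \<P>(\<omega> in M. lambda_min (sample_cov n Xs \<omega>) \<le> t) \<le> (K * t) powr p"
  shows "Lq_norm M q (\<lambda>\<omega>. max 1 (inv_lambda_min n Xs \<omega>)) \<le> ennreal (2 powr (1 / q) * K)"
proof -
  interpret prob_space M by fact
  let ?l = "\<lambda>\<omega>. lambda_min (sample_cov n Xs \<omega>)"
  note [measurable] = inv_lambda_min_measurable[OF meas]
  define Z where "Z \<omega> = ennreal_powr (inv_lambda_min n Xs \<omega>) q * ennreal (K powr (- q))" for \<omega>
  have [measurable]: "Z \<in> borel_measurable M" unfolding Z_def by measurable
  have dom: "ennreal_powr (max 1 (inv_lambda_min n Xs \<omega>)) q \<le> ennreal (K powr q) * max 1 (Z \<omega>)" for \<omega>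
  proof (cases "inv_lambda_min n Xs \<omega>")
    case top
    then show ?thesis using K by (simp add: Z_def ennreal_powr_def ennreal_mult_top ennreal_top_mult)
  next
    case (real a)
    have "max 1 (ennreal a) = ennreal (max 1 a)" using real by (auto simp: max_def simp flip: ennreal_1)
    then have "ennreal_powr (max 1 (inv_lambda_min n Xs \<omega>)) q = ennreal (max 1 a powr q)"
      using real by (simp add: ennreal_powr_ennreal)
    also have "\<dots> \<le> ennreal (K powr q * max 1 (a powr q * K powr (- q)))"
    proof (rule ennreal_leI)
      have "max 1 a powr q \<le> max (K powr q) (a powr q)"
        using K q real ge_one_powr_ge_zero[of K q] by (auto simp: max_def)
      also have "\<dots> = K powr q * max 1 (a powr q * K powr (- q))"
        using K by (simp add: max_mult_distrib_left powr_minus field_simps)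
      finally show "max 1 a powr q \<le> K powr q * max 1 (a powr q * K powr (- q))" .
    qed
    also have "\<dots> = ennreal (K powr q) * max 1 (Z \<omega>)"
    proof -
      have "Z \<omega> = ennreal (a powr q * K powr (- q))"
        using real by (simp add: Z_def ennreal_powr_ennreal ennreal_mult)
      then have "max 1 (Z \<omega>) = ennreal (max 1 (a powr q * K powr (- q)))"
        by (simp add: max_def flip: ennreal_1)
      then show ?thesis by (simp add: ennreal_mult)
    qed
    finally show ?thesis .
  qed
  have Ztail: "emeasure M {\<omega>\<in>space M. ennreal s \<le> Z \<omega>} \<le> ennreal (1 / s\<^sup>2)" if s: "s \<ge> 1" for s
  proof -
    define \<tau> where "\<tau> = s powr (- 1 / q) / K"
    have \<tau>: "\<tau> > 0" using s K by (simp add: \<tau>_def)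
    have imp: "?l \<omega> \<le> \<tau>" if "ennreal s \<le> Z \<omega>" for \<omega>
    proof (rule ccontr)
      assume "\<not> ?l \<omega> \<le> \<tau>"
      then have gt: "?l \<omega> > \<tau>" by simp
      then have pos: "?l \<omega> > 0" using \<tau> by simp
      have "Z \<omega> = ennreal ((1 / ?l \<omega>) powr q * K powr (- q))"
        using pos by (simp add: Z_def inv_lambda_min_def inverse_ennreal inverse_eq_divide ennreal_powr_ennreal ennreal_mult)
      then have "s \<le> (1 / ?l \<omega>) powr q * K powr (- q)"
        using that by (simp add: ennreal_le_iff)
      also have "\<dots> < (1 / \<tau>) powr q * K powr (- q)"
        using gt \<tau> q K by (intro mult_strict_right_mono powr_less_mono2 divide_strict_left_mono) auto
      also have "\<dots> = s"
        using s K q by (simp add: \<tau>_def powr_divide powr_mult powr_powr powr_minus field_simps)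
      finally show False by simp
    qed
    have "prob {\<omega>\<in>space M. ennreal s \<le> Z \<omega>} \<le> prob {\<omega>\<in>space M. ?l \<omega> \<le> \<tau>}"
      using imp by (intro finite_measure_mono) auto
    also have "\<dots> \<le> (K * \<tau>) powr p" by (rule tail[OF \<tau>])
    also have "\<dots> = s powr (- (p / q))" using K by (simp add: \<tau>_def powr_powr)
    also have "\<dots> \<le> s powr (- 2)" using s q by (intro powr_mono) (auto simp: field_simps)
    also have "\<dots> = 1 / s\<^sup>2" using s by (simp add: powr_minus_divide)
    finally show ?thesis by (simp add: emeasure_eq_measure ennreal_leI)
  qed
  have "(\<integral>\<^sup>+\<omega>. ennreal_powr (max 1 (inv_lambda_min n Xs \<omega>)) q \<partial>M) \<le> (\<integral>\<^sup>+\<omega>. ennreal (K powr q) * max 1 (Z \<omega>) \<partial>M)"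
    by (intro nn_integral_mono dom)
  also have "\<dots> = ennreal (K powr q) * (\<integral>\<^sup>+\<omega>. max 1 (Z \<omega>) \<partial>M)"
    by (rule nn_integral_cmult) measurable
  also have "\<dots> \<le> ennreal (K powr q) * 2"
    by (intro mult_left_mono nn_integral_max_one_le_two Ztail) auto
  also have "\<dots> = ennreal (2 * K powr q)"
    by (simp add: ennreal_mult mult.commute)
  finally have "Lq_norm M q (\<lambda>\<omega>. max 1 (inv_lambda_min n Xs \<omega>)) \<le> ennreal_powr (ennreal (2 * K powr q)) (1 / q)"
    unfolding Lq_norm_def using q by (intro ennreal_powr_mono) auto
  also have "\<dots> = ennreal (2 powr (1 / q) * K)"
    using K q by (simp add: ennreal_powr_ennreal powr_mult powr_powr)
  finally show ?thesis .
qed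

text \<open>
  Markov's inequality for the q-th moment gives the bound 2 (K t)^q, and 2 \<le> 2^q.
\<close>
lemma lambda_min_tail_le_of_Lq_norm_le:
  assumes M: "prob_space M"
    and meas[measurable]: "(\<lambda>\<omega>. lambda_min (sample_cov n Xs \<omega>)) \<in> borel_measurable M"
    and K: "K > 0" and q: "q \<ge> 1" and t: "t > 0"
    and bound: "Lq_norm M q (\<lambda>\<omega>. max 1 (inv_lambda_min n Xs \<omega>)) \<le> ennreal (2 powr (1 / q) * K)"
  shows "\<P>(\<omega> in M. lambda_min (sample_cov n Xs \<omega>) \<le> t) \<le> (2 * K * t) powr q"
proof -
  interpret prob_space M by fact
  note [measurable] = inv_lambda_min_measurable[OF meas]
  let ?W = "\<lambda>\<omega>. ennreal_powr (max 1 (inv_lambda_min n Xs \<omega>)) q"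
  let ?E = "{\<omega>\<in>space M. lambda_min (sample_cov n Xs \<omega>) \<le> t}"
  define J where "J = (\<integral>\<^sup>+\<omega>. ?W \<omega> \<partial>M)"
  have J: "ennreal_powr J (1 / q) \<le> ennreal (2 powr (1 / q) * K)"
    using bound by (simp add: Lq_norm_def J_def)
  have "J \<le> ennreal (2 * K powr q)"
  proof (cases J)
    case top
    then show ?thesis using J by (simp add: ennreal_powr_def top_unique)
  next
    case (real j)
    then have "j powr (1 / q) \<le> 2 powr (1 / q) * K"
      using J K by (simp add: ennreal_powr_ennreal ennreal_le_iff)
    then have "(j powr (1 / q)) powr q \<le> (2 powr (1 / q) * K) powr q"
      using q by (intro powr_mono2) auto
    then show ?thesis using real q K by (simp add: powr_powr powr_mult ennreal_leI)
  qed
  moreover have "ennreal ((1 / t) powr q * prob ?E) \<le> J"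
  proof -
    have "ennreal ((1 / t) powr q * prob ?E) = (\<integral>\<^sup>+\<omega>. ennreal ((1 / t) powr q) * indicator ?E \<omega> \<partial>M)"
      by (simp add: nn_integral_cmult emeasure_eq_measure ennreal_mult)
    also have "\<dots> \<le> J"
      unfolding J_def
    proof (rule nn_integral_mono)
      fix \<omega>
      have "ennreal ((1 / t) powr q) \<le> ?W \<omega>" if "\<omega> \<in> ?E"
      proof -
        have "ennreal (1 / t) \<le> max 1 (inv_lambda_min n Xs \<omega>)"
          using inv_lambda_min_ge[of n Xs \<omega> t] that t by (simp add: le_max_iff_disj)
        then have "ennreal_powr (ennreal (1 / t)) q \<le> ?W \<omega>" using q by (intro ennreal_powr_mono) auto
        then show ?thesis using t by (simp add: ennreal_powr_ennreal)
      qed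
      then show "ennreal ((1 / t) powr q) * indicator ?E \<omega> \<le> ?W \<omega>" by (auto split: split_indicator)
    qed
    finally show ?thesis .
  qed
  ultimately have "ennreal ((1 / t) powr q * prob ?E) \<le> ennreal (2 * K powr q)" by (rule order_trans[rotated])
  then have "(1 / t) powr q * prob ?E \<le> 2 * K powr q" by (subst (asm) ennreal_le_iff) auto
  then have "prob ?E \<le> 2 * (K powr q * t powr q)"
    using t by (simp add: powr_divide field_simps)
  also have "\<dots> \<le> 2 powr q * (K powr q * t powr q)"
    using powr_mono[of 1 q 2] q by (intro mult_right_mono) auto
  also have "\<dots> = (2 * K * t) powr q" using K t by (simp add: powr_mult)
  finally show ?thesis .
qed

section \<open>Divergence of high moments in dimension at least two\<close>

text \<open>
  The slope a/b lies in [-1, 1], so the grid of mesh 1/K has a point within 1/K of it.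
\<close>
lemma exists_grid_direction:
  fixes a b :: real and K :: nat
  assumes "K \<ge> 1" "\<bar>a\<bar> \<le> \<bar>b\<bar>" "\<bar>b\<bar> \<le> 2"
  shows "\<exists>j\<in>{- int K..int K}. \<bar>a - of_int j / real K * b\<bar> \<le> 2 / real K"
proof -
  define z where "z = a / b"
  have az: "a = z * b" using assms by (cases "b = 0") (auto simp: z_def)
  have z: "\<bar>z\<bar> \<le> 1" using assms by (cases "b = 0") (auto simp: z_def divide_le_eq)
  define j where "j = \<lfloor>real K * z\<rfloor>"
  have K: "real K > 0" using assms by simp
  have Kz: "\<bar>real K * z\<bar> \<le> real K" using z K by (simp add: abs_mult mult_left_le)
  have "j \<in> {- int K..int K}"
    using Kz unfolding j_def by (auto simp: le_floor_iff floor_le_iff)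
  moreover have "\<bar>a - of_int j / real K * b\<bar> \<le> 2 / real K"
  proof -
    have "a - of_int j / real K * b = (real K * z - of_int j) * b / real K"
      using K by (simp add: az field_simps)
    also have "\<bar>\<dots>\<bar> = \<bar>real K * z - of_int j\<bar> * \<bar>b\<bar> / real K"
      using K by (simp add: abs_mult)
    also have "\<dots> \<le> 1 * 2 / real K"
      using assms(3) K unfolding j_def by (intro divide_right_mono mult_mono) linarith+
    finally show ?thesis by simp
  qed
  ultimately show ?thesis by blast
qed

text \<open>
  The grid directions are the vectors e_k - (j/K) e_l and e_l - (j/K) e_k with |j| \<le> K, at most
  6K in number. Off the event B, which has probability at most 1/2, one of them is almost
  orthogonal to X, so the best of them has probability at least (1/2) / (6K).
\<close>
lemma exists_direction_small_ball_ge: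
  fixes X :: "'b \<Rightarrow> real^'d" and K :: nat
  assumes N: "prob_space N" and X[measurable]: "X \<in> borel_measurable N"
    and id: "identity_second_moment N X" and d: "CARD('d) \<ge> 2" and K: "K \<ge> 1"
  obtains v where "norm v \<ge> 1"
    and "\<P>(\<omega> in N. \<bar>v \<bullet> X \<omega>\<bar> \<le> 2 / real K) \<ge> 1 / (12 * real K)"
proof -
  interpret prob_space N by fact
  obtain k l :: 'd where kl: "k \<noteq> l"
    using d card_2_iff' ex_card[OF d] by (metis UNIV_I)
  let ?J = "{- int K..int K}"
  define u1 u2 where "u1 j = axis k 1 - (of_int j / real K) *\<^sub>R axis l (1::real)"
    and "u2 j = axis l 1 - (of_int j / real K) *\<^sub>R axis k (1::real)" for j
  define F where "F = u1 ` ?J \<union> u2 ` ?J"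
  have norm: "norm v \<ge> 1" if v: "v \<in> F" for v
  proof -
    have "\<bar>v $ k\<bar> = 1 \<or> \<bar>v $ l\<bar> = 1"
      using v kl by (auto simp: F_def u1_def u2_def axis_def)
    then show ?thesis using component_le_norm_cart[of v k] component_le_norm_cart[of v l] by auto
  qed
  have cardF: "real (card F) \<le> 6 * real K"
  proof -
    have "card F \<le> card (u1 ` ?J) + card (u2 ` ?J)" unfolding F_def by (rule card_Un_le)
    also have "\<dots> \<le> card ?J + card ?J" by (intro add_mono card_image_le) auto
    also have "\<dots> \<le> 6 * K" using K by simp
    finally show ?thesis by linarith
  qed
  have finF: "finite F" by (simp add: F_def)
  define A where "A v = {\<omega>\<in>space N. \<bar>v \<bullet> X \<omega>\<bar> \<le> 2 / real K}" for v
  have [measurable]: "A v \<in> sets N" for v unfolding A_def by measurable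
  define B where "B = {\<omega>\<in>space N. 4 \<le> (X \<omega> $ k)\<^sup>2 + (X \<omega> $ l)\<^sup>2}"
  have [measurable]: "B \<in> sets N" unfolding B_def by measurable
  have "has_bochner_integral N (\<lambda>\<omega>. (X \<omega> $ k)\<^sup>2 + (X \<omega> $ l)\<^sup>2) (1 + 1)"
    by (intro has_bochner_integral_add identity_second_moment_coordinate id)
  then have "prob B \<le> 2 / 4"
    using integral_Markov_inequality_measure[of N "\<lambda>\<omega>. (X \<omega> $ k)\<^sup>2 + (X \<omega> $ l)\<^sup>2" "{}" 4]
    by (auto simp: has_bochner_integral_iff B_def)
  have cover: "space N - B \<subseteq> (\<Union>v\<in>F. A v)"
  proof
    fix \<omega> assume \<omega>: "\<omega> \<in> space N - B"
    let ?a = "X \<omega> $ k" and ?b = "X \<omega> $ l"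
    have "?a\<^sup>2 + ?b\<^sup>2 \<le> 2\<^sup>2" using \<omega> by (auto simp: B_def not_le)
    then have "?a\<^sup>2 \<le> 2\<^sup>2" "?b\<^sup>2 \<le> 2\<^sup>2" using zero_le_power2[of ?a] zero_le_power2[of ?b] by linarith+
    then have b: "\<bar>?a\<bar> \<le> 2" "\<bar>?b\<bar> \<le> 2" 
      using abs_le_square_iff[of ?a 2] abs_le_square_iff[of ?b 2] by auto
    have u: "u1 j \<bullet> X \<omega> = ?a - of_int j / real K * ?b" "u2 j \<bullet> X \<omega> = ?b - of_int j / real K * ?a" for j
      by (simp_all add: u1_def u2_def inner_diff_left inner_axis')
    show "\<omega> \<in> (\<Union>v\<in>F. A v)"
    proof (cases "\<bar>?a\<bar> \<le> \<bar>?b\<bar>")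
      case True
      then obtain j where "j \<in> ?J" "\<bar>u1 j \<bullet> X \<omega>\<bar> \<le> 2 / real K"
        using exists_grid_direction[OF K True b(2)] unfolding u by blast
      then show ?thesis using \<omega> by (auto simp: F_def A_def)
    next
      case False
      then obtain j where "j \<in> ?J" "\<bar>u2 j \<bullet> X \<omega>\<bar> \<le> 2 / real K"
        using exists_grid_direction[OF K _ b(1), of ?b] unfolding u by auto
      then show ?thesis using \<omega> by (auto simp: F_def A_def)
    qed
  qed
  have "\<exists>v\<in>F. prob (A v) \<ge> 1 / (12 * real K)"
  proof (rule ccontr)
    assume "\<not> ?thesis"
    then have less: "prob (A v) < 1 / (12 * real K)" if "v \<in> F" for v using that by (auto simp: not_le)
    have "F \<noteq> {}" using K by (auto simp: F_def)
    have "1 / 2 \<le> prob (space N - B)" using \<open>prob B \<le> 2 / 4\<close> by (simp add: prob_compl)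
    also have "\<dots> \<le> prob (\<Union>v\<in>F. A v)"
      using cover finF by (intro finite_measure_mono sets.finite_UN) auto
    also have "\<dots> \<le> (\<Sum>v\<in>F. prob (A v))"
      using finF by (intro finite_measure_subadditive_finite) auto
    also have "\<dots> < (\<Sum>v\<in>F. 1 / (12 * real K))"
      using finF \<open>F \<noteq> {}\<close> less by (intro sum_strict_mono) auto
    also have "\<dots> = real (card F) * (1 / (12 * real K))" by simp
    also have "\<dots> \<le> (6 * real K) * (1 / (12 * real K))" using cardF by (intro mult_right_mono) auto
    also have "\<dots> = 1 / 2" using K by simp
    finally show False by simp
  qed
  then show ?thesis using that norm unfolding A_def by blast
qed

text \<open>
  A tail of order 1/z has infinite mean: each geometric level b^k contributes at least c, and the
  levels below z add up to at most 2z because b \<ge> 2.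
\<close>
lemma nn_integral_eq_infinity_of_heavy_tail:
  fixes Z :: "'a \<Rightarrow> ennreal" and b c :: real
  assumes [measurable]: "Z \<in> borel_measurable M" and b: "b \<ge> 2" and c: "c > 0"
    and tail: "\<And>k::nat. emeasure M {\<omega>\<in>space M. ennreal (b ^ k) \<le> Z \<omega>} \<ge> ennreal (c / b ^ k)"
  shows "(\<integral>\<^sup>+\<omega>. Z \<omega> \<partial>M) = \<infinity>"
proof -
  have geo: "(\<Sum>k<Suc m. b ^ k) \<le> 2 * b ^ m" for m
  proof (induction m)
    case (Suc m)
    have "2 * b ^ m \<le> b * b ^ m" using b by (intro mult_right_mono) auto
    with Suc show ?case by simp
  qed simp
  have dom: "(\<Sum>k<m. ennreal (b ^ k) * indicator {y. ennreal (b ^ k) \<le> y} z) \<le> 2 * z" for m :: nat and z :: ennreal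
  proof (induction m)
    case (Suc m)
    show ?case
    proof (cases "ennreal (b ^ m) \<le> z")
      case True
      have "(\<Sum>k<Suc m. ennreal (b ^ k) * indicator {y. ennreal (b ^ k) \<le> y} z) \<le> (\<Sum>k<Suc m. ennreal (b ^ k))"
        by (intro sum_mono) (auto split: split_indicator)
      also have "\<dots> = ennreal (\<Sum>k<Suc m. b ^ k)" using b by (intro sum_ennreal) auto
      also have "\<dots> \<le> ennreal (2 * b ^ m)" by (intro ennreal_leI geo)
      also have "\<dots> = 2 * ennreal (b ^ m)" using b by (simp add: ennreal_mult)
      also have "\<dots> \<le> 2 * z" using True by (intro mult_left_mono) auto
      finally show ?thesis .
    next
      case False
      then show ?thesis using Suc by simp
    qed
  qed simp
  have "ennreal (real m * c) \<le> 2 * (\<integral>\<^sup>+\<omega>. Z \<omega> \<partial>M)" for m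
  proof -
    have "ennreal (real m * c) = (\<Sum>k<m. ennreal c)"
      using c by (simp add: ennreal_mult ennreal_of_nat_eq_real_of_nat)
    also have "\<dots> \<le> (\<Sum>k<m. ennreal (b ^ k) * emeasure M {\<omega>\<in>space M. ennreal (b ^ k) \<le> Z \<omega>})"
    proof (rule sum_mono)
      fix k
      have "ennreal c = ennreal (b ^ k) * ennreal (c / b ^ k)"
        using b c by (simp add: ennreal_mult[symmetric])
      also have "\<dots> \<le> ennreal (b ^ k) * emeasure M {\<omega>\<in>space M. ennreal (b ^ k) \<le> Z \<omega>}"
        by (intro mult_left_mono tail) auto
      finally show "ennreal c \<le> \<dots>" .
    qed
    also have "\<dots> = (\<Sum>k<m. \<integral>\<^sup>+\<omega>. ennreal (b ^ k) * indicator {\<omega>\<in>space M. ennreal (b ^ k) \<le> Z \<omega>} \<omega> \<partial>M)"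
      by (simp add: nn_integral_cmult)
    also have "\<dots> = (\<integral>\<^sup>+\<omega>. (\<Sum>k<m. ennreal (b ^ k) * indicator {\<omega>\<in>space M. ennreal (b ^ k) \<le> Z \<omega>} \<omega>) \<partial>M)"
      by (rule nn_integral_sum[symmetric]) measurable
    also have "\<dots> \<le> (\<integral>\<^sup>+\<omega>. 2 * Z \<omega> \<partial>M)"
    proof (rule nn_integral_mono)
      fix \<omega> assume "\<omega> \<in> space M"
      then have "(\<Sum>k<m. ennreal (b ^ k) * indicator {\<omega>\<in>space M. ennreal (b ^ k) \<le> Z \<omega>} \<omega>)
          = (\<Sum>k<m. ennreal (b ^ k) * indicator {y. ennreal (b ^ k) \<le> y} (Z \<omega>))"
        by (intro sum.cong) (auto split: split_indicator)
      then show "(\<Sum>k<m. ennreal (b ^ k) * indicator {\<omega>\<in>space M. ennreal (b ^ k) \<le> Z \<omega>} \<omega>) \<le> 2 * Z \<omega>"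
        using dom[where m=m and z="Z \<omega>"] by simp
    qed
    also have "\<dots> = 2 * (\<integral>\<^sup>+\<omega>. Z \<omega> \<partial>M)" by (rule nn_integral_cmult) measurable
    finally show ?thesis .
  qed
  note bound = this
  show ?thesis
  proof (cases "\<integral>\<^sup>+\<omega>. Z \<omega> \<partial>M")
    case (real y)
    obtain m :: nat where m: "2 * y / c < real m" using reals_Archimedean2 by blast
    have "ennreal (real m * c) \<le> ennreal (2 * y)" using bound[of m] real by (simp add: ennreal_mult)
    then have "real m * c \<le> 2 * y" using real by (subst (asm) ennreal_le_iff) auto
    then show ?thesis using m c by (simp add: field_simps)
  qed simp
qed

lemma lambda_min_lower_tail_ge:
  fixes M :: "'a measure" and N :: "'b measure"
    and X :: "'b \<Rightarrow> real^'d" and Xs :: "nat \<Rightarrow> 'a \<Rightarrow> real^'d" and K :: nat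
  assumes N: "prob_space N" and X[measurable]: "X \<in> borel_measurable N"
    and M: "prob_space M" and n: "n \<ge> 1" and iid: "iid_copies M n Xs N X"
    and id: "identity_second_moment N X" and d: "CARD('d) \<ge> 2" and K: "K \<ge> 1"
  shows "\<P>(\<omega> in M. lambda_min (sample_cov n Xs \<omega>) \<le> (2 / real K)\<^sup>2) \<ge> (1 / (12 * real K)) ^ n"
proof -
  interpret N: prob_space N by fact
  interpret M: prob_space M by fact
  obtain v :: "real^'d" where v: "norm v \<ge> 1"
      "measure N {\<omega>\<in>space N. \<bar>v \<bullet> X \<omega>\<bar> \<le> 2 / real K} \<ge> 1 / (12 * real K)"
    using exists_direction_small_ball_ge[OF N X id d K] by blast
  define S where "S = {x. \<bar>v \<bullet> x\<bar> \<le> 2 / real K}"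
  have [measurable]: "S \<in> sets borel" unfolding S_def by measurable
  have [measurable]: "(\<lambda>\<omega>. lambda_min (sample_cov n Xs \<omega>)) \<in> borel_measurable M"
    using iid_copies_measurable[OF M iid] by (rule lambda_min_sample_cov_measurable)
  let ?E = "{\<omega>\<in>space M. lambda_min (sample_cov n Xs \<omega>) \<le> (2 / real K)\<^sup>2}"
  have "ennreal ((1 / (12 * real K)) ^ n) = ennreal (1 / (12 * real K)) ^ n"
    by (simp add: ennreal_power)
  also have "\<dots> \<le> (\<integral>\<^sup>+\<omega>. indicator S (X \<omega>) \<partial>N) ^ n"
  proof (rule power_mono)
    have "(\<integral>\<^sup>+\<omega>. indicator S (X \<omega>) \<partial>N) = (\<integral>\<^sup>+\<omega>. indicator {\<omega>\<in>space N. \<bar>v \<bullet> X \<omega>\<bar> \<le> 2 / real K} \<omega> \<partial>N)"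
      by (intro nn_integral_cong) (auto simp: S_def split: split_indicator)
    then show "ennreal (1 / (12 * real K)) \<le> (\<integral>\<^sup>+\<omega>. indicator S (X \<omega>) \<partial>N)"
      using v(2) by (simp add: N.emeasure_eq_measure ennreal_leI)
  qed simp
  also have "\<dots> = (\<integral>\<^sup>+\<omega>. (\<Prod>i=1..n. indicator S (Xs i \<omega>)) \<partial>M)"
    by (rule iid_copies_nn_integral_prod[OF M iid X, symmetric]) measurable
  also have "\<dots> \<le> (\<integral>\<^sup>+\<omega>. indicator ?E \<omega> \<partial>M)"
  proof (rule nn_integral_mono)
    fix \<omega> assume \<omega>: "\<omega> \<in> space M"
    show "(\<Prod>i=1..n. indicator S (Xs i \<omega>)) \<le> (indicator ?E \<omega> :: ennreal)"
    proof (cases "\<forall>i\<in>{1..n}. Xs i \<omega> \<in> S")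
      case True
      have "lambda_min (sample_cov n Xs \<omega>) \<le> lambda_min (sample_cov n Xs \<omega>) * (norm v)\<^sup>2"
        using v(1) lambda_min_sample_cov_nonneg[of n Xs \<omega>] by (simp add: mult_le_cancel_left1)
      also have "\<dots> \<le> (\<Sum>i=1..n. (v \<bullet> Xs i \<omega>)\<^sup>2) / real n" by (rule lambda_min_sample_cov_le)
      also have "\<dots> \<le> (\<Sum>i=1..n. (2 / real K)\<^sup>2) / real n"
        using True by (intro divide_right_mono sum_mono) (auto simp: S_def abs_le_square_iff[symmetric])
      also have "\<dots> = (2 / real K)\<^sup>2" using n by simp
      finally have "\<omega> \<in> ?E" using \<omega> by simp
      then show ?thesis using True by simp
    next
      case False
      then obtain i where "i \<in> {1..n}" "Xs i \<omega> \<notin> S" by blast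
      then have "(\<Prod>i=1..n. indicator S (Xs i \<omega>)) = (0::ennreal)"
        by (intro prod_zero bexI[of _ i]) auto
      then show ?thesis by (simp only: zero_le)
    qed
  qed
  also have "\<dots> = ennreal (measure M ?E)" by (simp add: M.emeasure_eq_measure)
  finally show ?thesis by (simp add: ennreal_le_iff)
qed

text \<open>
  At K = 2^(k+1) the lower bound on the tail says that the q-th power of the inverse eigenvalue is at
  least 4^(kq) \<ge> 2^(nk) with probability at least 24^(-n) 2^(-nk), a tail of order 1/z.
\<close>
lemma Lq_norm_inv_lambda_min_eq_infinity:
  fixes M :: "'a measure" and N :: "'b measure"
    and X :: "'b \<Rightarrow> real^'d" and Xs :: "nat \<Rightarrow> 'a \<Rightarrow> real^'d"
  assumes N: "prob_space N" and X: "X \<in> borel_measurable N"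
    and M: "prob_space M" and n: "n \<ge> 1" and iid: "iid_copies M n Xs N X"
    and id: "identity_second_moment N X" and d: "CARD('d) \<ge> 2" and q: "q \<ge> real n / 2"
  shows "Lq_norm M q (inv_lambda_min n Xs) = \<infinity>"
proof -
  interpret prob_space M by fact
  have meas[measurable]: "(\<lambda>\<omega>. lambda_min (sample_cov n Xs \<omega>)) \<in> borel_measurable M"
    using iid_copies_measurable[OF M iid] by (rule lambda_min_sample_cov_measurable)
  note [measurable] = inv_lambda_min_measurable[OF meas]
  have q0: "q > 0" using q n by simp
  let ?Z = "\<lambda>\<omega>. ennreal_powr (inv_lambda_min n Xs \<omega>) q"
  have "(\<integral>\<^sup>+\<omega>. ?Z \<omega> \<partial>M) = \<infinity>"
  proof (rule nn_integral_eq_infinity_of_heavy_tail[where b="2 ^ n" and c="(1 / 24) ^ n"])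
    show "2 \<le> (2::real) ^ n" using power_increasing[of 1 n "2::real"] n by simp
    fix k :: nat
    have imp: "ennreal ((2 ^ n) ^ k) \<le> ?Z \<omega>" if "lambda_min (sample_cov n Xs \<omega>) \<le> (2 / real (2 ^ Suc k))\<^sup>2" for \<omega>
    proof -
      have "(2 / real (2 ^ Suc k))\<^sup>2 = 1 / 4 ^ k"
        by (simp add: power_divide power_mult_distrib power2_eq_square flip: power_mult_distrib)
      then have T: "ennreal (4 ^ k) \<le> inv_lambda_min n Xs \<omega>"
        using inv_lambda_min_ge[of n Xs \<omega> "1 / 4 ^ k"] that by simp
      have "((2::real) ^ n) ^ k = (4 ^ k) powr (real n / 2)"
      proof -
        have "(4::real) ^ k = 2 powr (2 * real k)"
          by (simp add: powr_realpow[symmetric] powr_powr[symmetric])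
        then have "(4 ^ k) powr (real n / 2) = 2 powr (real (n * k))"
          by (simp add: powr_powr mult.commute)
        also have "\<dots> = 2 ^ (n * k)" by (rule powr_realpow) simp
        finally show ?thesis by (simp add: power_mult)
      qed
      also have "\<dots> \<le> (4 ^ k) powr q" using q by (intro powr_mono) auto
      finally have "ennreal ((2 ^ n) ^ k) \<le> ennreal_powr (ennreal (4 ^ k)) q"
        by (simp add: ennreal_powr_ennreal ennreal_leI)
      also have "\<dots> \<le> ?Z \<omega>" using T q0 by (rule ennreal_powr_mono)
      finally show ?thesis .
    qed
    have "(1 / 24) ^ n / (2 ^ n) ^ k = (1 / (12 * real (2 ^ Suc k))) ^ n"
      by (simp add: power_divide power_mult_distrib power_mult[symmetric] mult.commute field_simps)
    also have "\<dots> \<le> prob {\<omega>\<in>space M. lambda_min (sample_cov n Xs \<omega>) \<le> (2 / real (2 ^ Suc k))\<^sup>2}"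
      by (rule lambda_min_lower_tail_ge[OF N X M n iid id d]) simp
    also have "\<dots> \<le> prob {\<omega>\<in>space M. ennreal ((2 ^ n) ^ k) \<le> ?Z \<omega>}"
      using imp by (intro finite_measure_mono) auto
    finally show "ennreal ((1 / 24) ^ n / (2 ^ n) ^ k) \<le> emeasure M {\<omega>\<in>space M. ennreal ((2 ^ n) ^ k) \<le> ?Z \<omega>}"
      by (simp only: emeasure_eq_measure ennreal_leI)
  qed auto
  then show ?thesis by (simp add: Lq_norm_def ennreal_powr_def)
qed

section \<open>Moments of the inverse smallest eigenvalue\<close>

theorem corollary4:
  fixes M :: "'a measure" and N :: "'b measure"
    and X :: "'b \<Rightarrow> real^'d" and Xs :: "nat \<Rightarrow> 'a \<Rightarrow> real^'d" and n :: nat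
  assumes "prob_space N" and "X \<in> borel_measurable N"
    and "prob_space M" and "n \<ge> 1" and "iid_copies M n Xs N X"
    and "identity_second_moment N X"
  shows
    "(\<forall>C \<alpha> :: real. C \<ge> 1 \<longrightarrow> 0 < \<alpha> \<longrightarrow> \<alpha> \<le> 1 \<longrightarrow>
        real n \<ge> 6 * real CARD('d) / \<alpha> \<longrightarrow> real n \<ge> 12 / \<alpha> \<longrightarrow>
        (let C' = 3 * C ^ 4 * exp (1 + 9 / \<alpha>) in
          ((\<forall>\<theta>\<in>sphere 0 1. \<forall>t>0. \<P>(\<omega> in N. \<bar>\<theta> \<bullet> X \<omega>\<bar> \<le> t) \<le> (C * t) powr \<alpha>) \<longrightarrow>
             (\<forall>q. 1 \<le> q \<and> q \<le> \<alpha> * real n / 12 \<longrightarrow>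
                Lq_norm M q (\<lambda>\<omega>. max 1 (inv_lambda_min n Xs \<omega>)) \<le> ennreal (2 powr (1 / q) * C')))
        \<and> ((\<forall>q. 1 \<le> q \<and> q \<le> \<alpha> * real n / 12 \<longrightarrow>
                Lq_norm M q (\<lambda>\<omega>. max 1 (inv_lambda_min n Xs \<omega>)) \<le> ennreal (2 powr (1 / q) * C')) \<longrightarrow>
             (\<forall>t. 0 < t \<and> t < 1 \<longrightarrow>
                \<P>(\<omega> in M. lambda_min (sample_cov n Xs \<omega>) \<le> t)
                  \<le> (2 * C' * t) powr (\<alpha> * real n / 12)))))
     \<and> (CARD('d) \<ge> 2 \<longrightarrow>
         (\<forall>q. q \<ge> real n / 2 \<longrightarrow> Lq_norm M q (inv_lambda_min n Xs) = \<infinity>))"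
proof (intro conjI impI allI)
  note N = assms(1) and X = assms(2) and M = assms(3) and n = assms(4) and iid = assms(5) and id = assms(6)
  have meas: "(\<lambda>\<omega>. lambda_min (sample_cov n Xs \<omega>)) \<in> borel_measurable M"
    using iid_copies_measurable[OF M iid] by (rule lambda_min_sample_cov_measurable)
  show "Lq_norm M q (inv_lambda_min n Xs) = \<infinity>" if "CARD('d) \<ge> 2" "q \<ge> real n / 2" for q
    by (rule Lq_norm_inv_lambda_min_eq_infinity[OF N X M n iid id that])
  fix C \<alpha> :: real
  assume C: "C \<ge> 1" and \<alpha>: "0 < \<alpha>" "\<alpha> \<le> 1" and nd: "real n \<ge> 6 * real CARD('d) / \<alpha>" and n12: "real n \<ge> 12 / \<alpha>"
  define C' where "C' = 3 * C ^ 4 * exp (1 + 9 / \<alpha>)"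
  have "1 * 1 * 1 \<le> C'"
    unfolding C'_def using C \<alpha> by (intro mult_mono one_le_power) auto
  then have C': "C' \<ge> 1" by simp
  have q12: "\<alpha> * real n / 12 \<ge> 1" using n12 \<alpha> by (simp add: field_simps)
  show "let C' = 3 * C ^ 4 * exp (1 + 9 / \<alpha>) in
          ((\<forall>\<theta>\<in>sphere 0 1. \<forall>t>0. \<P>(\<omega> in N. \<bar>\<theta> \<bullet> X \<omega>\<bar> \<le> t) \<le> (C * t) powr \<alpha>) \<longrightarrow>
             (\<forall>q. 1 \<le> q \<and> q \<le> \<alpha> * real n / 12 \<longrightarrow>
                Lq_norm M q (\<lambda>\<omega>. max 1 (inv_lambda_min n Xs \<omega>)) \<le> ennreal (2 powr (1 / q) * C')))
        \<and> ((\<forall>q. 1 \<le> q \<and> q \<le> \<alpha> * real n / 12 \<longrightarrow>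
                Lq_norm M q (\<lambda>\<omega>. max 1 (inv_lambda_min n Xs \<omega>)) \<le> ennreal (2 powr (1 / q) * C')) \<longrightarrow>
             (\<forall>t. 0 < t \<and> t < 1 \<longrightarrow>
                \<P>(\<omega> in M. lambda_min (sample_cov n Xs \<omega>) \<le> t)
                  \<le> (2 * C' * t) powr (\<alpha> * real n / 12)))"
    unfolding Let_def C'_def[symmetric]
  proof (intro conjI impI allI; (elim conjE)?)
    fix q
    assume small: "\<forall>\<theta>\<in>sphere 0 1. \<forall>t>0. \<P>(\<omega> in N. \<bar>\<theta> \<bullet> X \<omega>\<bar> \<le> t) \<le> (C * t) powr \<alpha>"
      and q: "1 \<le> q" "q \<le> \<alpha> * real n / 12"
    show "Lq_norm M q (\<lambda>\<omega>. max 1 (inv_lambda_min n Xs \<omega>)) \<le> ennreal (2 powr (1 / q) * C')"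
    proof (rule Lq_norm_inv_lambda_min_le[OF M meas C'])
      show "0 < q" "2 * q \<le> \<alpha> * real n / 6" using q by auto
      show "\<P>(\<omega> in M. lambda_min (sample_cov n Xs \<omega>) \<le> t) \<le> (C' * t) powr (\<alpha> * real n / 6)" if "t > 0" for t
        unfolding C'_def by (rule lambda_min_lower_tail[OF N X M n iid id C \<alpha> nd small that])
    qed
  next
    fix t :: real
    assume bound: "\<forall>q. 1 \<le> q \<and> q \<le> \<alpha> * real n / 12 \<longrightarrow>
        Lq_norm M q (\<lambda>\<omega>. max 1 (inv_lambda_min n Xs \<omega>)) \<le> ennreal (2 powr (1 / q) * C')"
      and t: "0 < t" "t < 1"
    show "\<P>(\<omega> in M. lambda_min (sample_cov n Xs \<omega>) \<le> t) \<le> (2 * C' * t) powr (\<alpha> * real n / 12)"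
    proof (rule lambda_min_tail_le_of_Lq_norm_le[OF M meas _ q12 t(1)])
      show "0 < C'" using C' by simp
      show "Lq_norm M (\<alpha> * real n / 12) (\<lambda>\<omega>. max 1 (inv_lambda_min n Xs \<omega>))
          \<le> ennreal (2 powr (1 / (\<alpha> * real n / 12)) * C')"
        using q12 by (intro bound[rule_format] conjI order_refl)
    qed
  qed
qed

end
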